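(* Let $\Gamma$ be a groupoid and let $R$ be a ring which is strongly graded by $\Gamma$. Suppose that, with respect to this grading, $R$ is object unital. Let $\Delta$ be a wide subgroupoid of $\Gamma$ and put $\Lambda := \mathrm{Iso}(\Delta)$. Then the ring extension $R/R_\Delta$ is separable if and only if for each $e \in \Gamma_0$, there exist $f \in [e]$ and $r \in C_{R_0}(R_\Lambda)$ satisfying $\mathrm{tr}_{\Gamma/\Delta}^f(r) = 1_{R_f}$.
   Context: Rings are associative but not necessarily unital; a unital ring has $1 \neq 0$. If $S$ is a subring of $R$, the ring extension $R/S$ is called separable if the multiplication map $\mu : R \otimes_S R \to R$, $r\otimes r' \mapsto rr'$, admits an $R$-bimodule section, i.e. an $R$-bimodule map $\delta : R \to R\otimes_S R$ with $\mu\circ\delta = \mathrm{id}_R$. A groupoid $\Gamma$ is a small category in which every morphism is an isomorphism. $\Gamma_0$ is its set of objects, identified with the identity morphisms; $\sigma \in \Gamma$ means that $\sigma$ is a morphism; $d(\sigma)$ and $r(\sigma)$ are its domain and range; $\Gamma(e,f)$ is the set of morphisms $e \to f$ and $\Gamma(e) := \Gamma(e,e)$; $\Gamma_2 := \{(\sigma,\tau) \mid d(\sigma) = r(\tau)\}$ is the set of composable pairs, with composite $\sigma\tau$. For $e \in \Gamma_0$, $[e] := \{ f \in \Gamma_0 \mid \Gamma(e,f) \neq \emptyset\}$. A subgroupoid $\Delta$ of $\Gamma$ is a subcategory which is a groupoid; it is wide if $\Delta_0 = \Gamma_0$. $\mathrm{Iso}(\Delta)$ is the groupoid with objects $\Delta_0$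 and morphisms $\bigcup_{e \in \Delta_0} \Delta(e)$. $R$ is graded by $\Gamma$ if there are additive subgroups $R_\sigma$ ($\sigma \in \Gamma$) with $R = \bigoplus_{\sigma\in\Gamma} R_\sigma$, $R_\sigma R_\tau \subseteq R_{\sigma\tau}$ if $(\sigma,\tau)\in\Gamma_2$, and $R_\sigma R_\tau = \{0\}$ otherwise; it is strongly graded if $R_\sigma R_\tau = R_{\sigma\tau}$ for all $(\sigma,\tau)\in\Gamma_2$ (where $R_\sigma R_\tau$ denotes the set of finite sums of products). The grading is object unital if each ring $R_e$, $e\in\Gamma_0$, is unital and $1_{R_{r(\sigma)}} x = x 1_{R_{d(\sigma)}} = x$ for all $\sigma \in \Gamma$, $x \in R_\sigma$. For a subset $X$ of $\Gamma$, $R_X := \bigoplus_{\delta \in X} R_\delta$; $R_0 := R_{\Gamma_0}$. For $X, Y\subseteq R$, $C_X(Y) := \{x\in X \mid xy = yx \text{ for all } y \in Y\}$. For each $\sigma\in\Gamma$ choose $n_\sigma \in \mathbb{N} = \{1,2,3,\ldots\}$, $u_\sigma^{(i)} \in R_\sigma$ and $v_{\sigma^{-1}}^{(i)} \in R_{\sigma^{-1}}$ ($1\le i \le n_\sigma$) with $\sum_{i=1}^{n_\sigma} u_\sigma^{(i)} v_{\sigma^{-1}}^{(i)} = 1_{R_{r(\sigma)}}$, and define $\gamma_\sigma : R\to R$ by $\gamma_\sigma(x) = \sum_{i=1}^{n_\sigma} u_\sigma^{(i)} x v_{\sigma^{-1}}^{(i)}$. Call $\sigma,\tau\in\Gamma$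 right $\Lambda$-equivalent if $\sigma\Lambda = \tau\Lambda$, where $\sigma\Lambda$ is the set of composites $\sigma\lambda$ with $\lambda \in \Lambda$, $(\sigma,\lambda)\in\Gamma_2$. Let $T$ be a set of representatives of the equivalence classes and $T_{f,e} := \{\tau\in T \mid d(\tau) = f,\ r(\tau) = e\}$. Let $\Gamma_0^{\mathrm{fin}} := \{f\in\Gamma_0 \mid [\Gamma(f):\Delta(f)] < \infty\}$ and define the relative trace map $\mathrm{tr}_{\Gamma/\Delta}^e : R\to R$ by $\mathrm{tr}_{\Gamma/\Delta}^e(x) = \sum_{f\in\Gamma_0^{\mathrm{fin}}} \sum_{\tau\in T_{f,e}} \gamma_\tau(x)$ for $e \in \Gamma_0$ (only finitely many terms are nonzero for each $x$). *)

theory Defs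
  imports "HOL-Algebra.Free_Abelian_Groups" "HOL-Algebra.Generated_Groups" "HOL-Algebra.Left_Coset"
begin

section \<open>Groupoids\<close>

text \<open>
  Small categories are presented one-sorted: objects are identified with their identity
  morphisms, so that \<open>dm\<close> and \<open>rg\<close> send a morphism to the identities of its domain and range.
  \<open>comp \<Gamma> \<sigma> \<tau>\<close> is the composite "first \<open>\<tau>\<close>, then \<open>\<sigma>\<close>" and is meaningful only if
  \<open>dm \<Gamma> \<sigma> = rg \<Gamma> \<tau>\<close>.
\<close>

record 'g cat =
  mor :: "'g set"
  dm :: "'g \<Rightarrow> 'g"
  rg :: "'g \<Rightarrow> 'g"
  comp :: "'g \<Rightarrow> 'g \<Rightarrow> 'g"

locale category =
  fixes \<Gamma> :: "'g cat"
  assumes dm_mor: "\<sigma> \<in> mor \<Gamma> \<Longrightarrow> dm \<Gamma> \<sigma> \<in> mor \<Gamma>"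
    and rg_mor: "\<sigma> \<in> mor \<Gamma> \<Longrightarrow> rg \<Gamma> \<sigma> \<in> mor \<Gamma>"
    and dm_dm: "\<sigma> \<in> mor \<Gamma> \<Longrightarrow> dm \<Gamma> (dm \<Gamma> \<sigma>) = dm \<Gamma> \<sigma>"
    and rg_dm: "\<sigma> \<in> mor \<Gamma> \<Longrightarrow> rg \<Gamma> (dm \<Gamma> \<sigma>) = dm \<Gamma> \<sigma>"
    and dm_rg: "\<sigma> \<in> mor \<Gamma> \<Longrightarrow> dm \<Gamma> (rg \<Gamma> \<sigma>) = rg \<Gamma> \<sigma>"
    and rg_rg: "\<sigma> \<in> mor \<Gamma> \<Longrightarrow> rg \<Gamma> (rg \<Gamma> \<sigma>) = rg \<Gamma> \<sigma>"
    and comp_mor: "\<sigma> \<in> mor \<Gamma> \<Longrightarrow> \<tau> \<in> mor \<Gamma> \<Longrightarrow> dm \<Gamma> \<sigma> = rg \<Gamma> \<tau> \<Longrightarrow> comp \<Gamma> \<sigma> \<tau> \<in> mor \<Gamma>"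
    and dm_comp: "\<sigma> \<in> mor \<Gamma> \<Longrightarrow> \<tau> \<in> mor \<Gamma> \<Longrightarrow> dm \<Gamma> \<sigma> = rg \<Gamma> \<tau> \<Longrightarrow> dm \<Gamma> (comp \<Gamma> \<sigma> \<tau>) = dm \<Gamma> \<tau>"
    and rg_comp: "\<sigma> \<in> mor \<Gamma> \<Longrightarrow> \<tau> \<in> mor \<Gamma> \<Longrightarrow> dm \<Gamma> \<sigma> = rg \<Gamma> \<tau> \<Longrightarrow> rg \<Gamma> (comp \<Gamma> \<sigma> \<tau>) = rg \<Gamma> \<sigma>"
    and comp_dm: "\<sigma> \<in> mor \<Gamma> \<Longrightarrow> comp \<Gamma> \<sigma> (dm \<Gamma> \<sigma>) = \<sigma>"
    and comp_rg: "\<sigma> \<in> mor \<Gamma> \<Longrightarrow> comp \<Gamma> (rg \<Gamma> \<sigma>) \<sigma> = \<sigma>"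
    and comp_assoc: "\<sigma> \<in> mor \<Gamma> \<Longrightarrow> \<tau> \<in> mor \<Gamma> \<Longrightarrow> \<rho> \<in> mor \<Gamma> \<Longrightarrow>
      dm \<Gamma> \<sigma> = rg \<Gamma> \<tau> \<Longrightarrow> dm \<Gamma> \<tau> = rg \<Gamma> \<rho> \<Longrightarrow>
      comp \<Gamma> (comp \<Gamma> \<sigma> \<tau>) \<rho> = comp \<Gamma> \<sigma> (comp \<Gamma> \<tau> \<rho>)"

definition is_inverse :: "'g cat \<Rightarrow> 'g \<Rightarrow> 'g \<Rightarrow> bool" where
  "is_inverse \<Gamma> \<sigma> \<tau> \<longleftrightarrow> \<tau> \<in> mor \<Gamma> \<and> dm \<Gamma> \<tau> = rg \<Gamma> \<sigma> \<and> rg \<Gamma> \<tau> = dm \<Gamma> \<sigma> \<and>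
     comp \<Gamma> \<sigma> \<tau> = rg \<Gamma> \<sigma> \<and> comp \<Gamma> \<tau> \<sigma> = dm \<Gamma> \<sigma>"

locale groupoid = category +
  assumes ex_inverse: "\<sigma> \<in> mor \<Gamma> \<Longrightarrow> \<exists>\<tau>. is_inverse \<Gamma> \<sigma> \<tau>"

definition ginv :: "'g cat \<Rightarrow> 'g \<Rightarrow> 'g" where
  "ginv \<Gamma> \<sigma> = (THE \<tau>. is_inverse \<Gamma> \<sigma> \<tau>)"

text \<open>
  Subgroupoids share domain, range and composition with \<open>\<Gamma>\<close>, so they are given by their set of
  morphisms. Accordingly, the next few notions take a set \<open>X\<close> of morphisms of \<open>\<Gamma>\<close>.
\<close>

definition obj :: "'g cat \<Rightarrow> 'g set \<Rightarrow> 'g set" where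
  "obj \<Gamma> X = dm \<Gamma> ` X"

definition hom_set :: "'g cat \<Rightarrow> 'g set \<Rightarrow> 'g \<Rightarrow> 'g \<Rightarrow> 'g set" where
  "hom_set \<Gamma> X e f = {\<sigma> \<in> X. dm \<Gamma> \<sigma> = e \<and> rg \<Gamma> \<sigma> = f}"

definition vertex_group :: "'g cat \<Rightarrow> 'g \<Rightarrow> 'g monoid" where
  "vertex_group \<Gamma> e = \<lparr>carrier = hom_set \<Gamma> (mor \<Gamma>) e e, mult = comp \<Gamma>, one = e\<rparr>"

definition obj_class :: "'g cat \<Rightarrow> 'g \<Rightarrow> 'g set" where
  "obj_class \<Gamma> e = {f \<in> obj \<Gamma> (mor \<Gamma>). hom_set \<Gamma> (mor \<Gamma>) e f \<noteq> {}}"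

definition subgroupoid :: "'g cat \<Rightarrow> 'g set \<Rightarrow> bool" where
  "subgroupoid \<Gamma> \<Delta> \<longleftrightarrow> \<Delta> \<subseteq> mor \<Gamma> \<and> groupoid (\<Gamma>\<lparr>mor := \<Delta>\<rparr>)"

definition wide_subgroupoid :: "'g cat \<Rightarrow> 'g set \<Rightarrow> bool" where
  "wide_subgroupoid \<Gamma> \<Delta> \<longleftrightarrow> subgroupoid \<Gamma> \<Delta> \<and> obj \<Gamma> \<Delta> = obj \<Gamma> (mor \<Gamma>)"

definition Iso :: "'g cat \<Rightarrow> 'g set \<Rightarrow> 'g set" where
  "Iso \<Gamma> \<Delta> = (\<Union>e \<in> obj \<Gamma> \<Delta>. hom_set \<Gamma> \<Delta> e e)"

definition right_translate :: "'g cat \<Rightarrow> 'g \<Rightarrow> 'g set \<Rightarrow> 'g set" where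
  "right_translate \<Gamma> \<sigma> \<Lambda> = {comp \<Gamma> \<sigma> \<tau> | \<tau>. \<tau> \<in> \<Lambda> \<and> dm \<Gamma> \<sigma> = rg \<Gamma> \<tau>}"

definition right_transversal :: "'g cat \<Rightarrow> 'g set \<Rightarrow> 'g set \<Rightarrow> bool" where
  "right_transversal \<Gamma> \<Lambda> T \<longleftrightarrow> T \<subseteq> mor \<Gamma> \<and>
     (\<forall>\<sigma> \<in> mor \<Gamma>. \<exists>!\<tau>. \<tau> \<in> T \<and> right_translate \<Gamma> \<sigma> \<Lambda> = right_translate \<Gamma> \<tau> \<Lambda>)"

definition fin_obj :: "'g cat \<Rightarrow> 'g set \<Rightarrow> 'g set" where
  "fin_obj \<Gamma> \<Delta> = {f \<in> obj \<Gamma> (mor \<Gamma>). finite (lcosets\<^bsub>vertex_group \<Gamma> f\<^esub> (hom_set \<Gamma> \<Delta> f f))}"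


section \<open>Groupoid graded rings\<close>

text \<open>
  The ring is the whole of a type of class \<open>ring\<close>, which is associative but need not have a unit.
\<close>

definition additive_subgroup :: "'r::ring set \<Rightarrow> bool" where
  "additive_subgroup A \<longleftrightarrow> 0 \<in> A \<and> (\<forall>x\<in>A. \<forall>y\<in>A. x - y \<in> A)"

definition is_subring :: "'r::ring set \<Rightarrow> bool" where
  "is_subring S \<longleftrightarrow> additive_subgroup S \<and> (\<forall>x\<in>S. \<forall>y\<in>S. x * y \<in> S)"

definition centralizer :: "'r::ring set \<Rightarrow> 'r set \<Rightarrow> 'r set" where
  "centralizer X Y = {x \<in> X. \<forall>y\<in>Y. x * y = y * x}"

definition sums_of_products :: "'r::ring set \<Rightarrow> 'r set \<Rightarrow> 'r set" where
  "sums_of_products A B =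
     {\<Sum>i<k. a i * b i | (k::nat) a b. \<forall>i<k. a i \<in> A \<and> b i \<in> B}"

definition is_ident :: "'r::ring set \<Rightarrow> 'r \<Rightarrow> bool" where
  "is_ident A u \<longleftrightarrow> u \<in> A \<and> u \<noteq> 0 \<and> (\<forall>x\<in>A. u * x = x \<and> x * u = x)"

definition ident :: "'r::ring set \<Rightarrow> 'r" where
  "ident A = (THE u. is_ident A u)"

text \<open>
  The second conjunct says that the ring is the internal direct sum of the \<open>R \<sigma>\<close>.
\<close>

definition graded :: "'g cat \<Rightarrow> ('g \<Rightarrow> 'r::ring set) \<Rightarrow> bool" where
  "graded \<Gamma> R \<longleftrightarrow>
     (\<forall>\<sigma> \<in> mor \<Gamma>. additive_subgroup (R \<sigma>)) \<and>
     (\<forall>x. \<exists>!h. (\<forall>\<sigma> \<in> mor \<Gamma>. h \<sigma> \<in> R \<sigma>) \<and> (\<forall>\<sigma>. \<sigma> \<notin> mor \<Gamma> \<longrightarrow> h \<sigma> = 0) \<and>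
        finite {\<sigma>. h \<sigma> \<noteq> 0} \<and> x = (\<Sum>\<sigma> | h \<sigma> \<noteq> 0. h \<sigma>)) \<and>
     (\<forall>\<sigma> \<in> mor \<Gamma>. \<forall>\<tau> \<in> mor \<Gamma>.
        if dm \<Gamma> \<sigma> = rg \<Gamma> \<tau> then sums_of_products (R \<sigma>) (R \<tau>) \<subseteq> R (comp \<Gamma> \<sigma> \<tau>)
        else sums_of_products (R \<sigma>) (R \<tau>) = {0})"

definition strongly_graded :: "'g cat \<Rightarrow> ('g \<Rightarrow> 'r::ring set) \<Rightarrow> bool" where
  "strongly_graded \<Gamma> R \<longleftrightarrow> graded \<Gamma> R \<and>
     (\<forall>\<sigma> \<in> mor \<Gamma>. \<forall>\<tau> \<in> mor \<Gamma>. dm \<Gamma> \<sigma> = rg \<Gamma> \<tau> \<longrightarrow>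
        sums_of_products (R \<sigma>) (R \<tau>) = R (comp \<Gamma> \<sigma> \<tau>))"

definition object_unital :: "'g cat \<Rightarrow> ('g \<Rightarrow> 'r::ring set) \<Rightarrow> bool" where
  "object_unital \<Gamma> R \<longleftrightarrow>
     (\<forall>e \<in> obj \<Gamma> (mor \<Gamma>). \<exists>u. is_ident (R e) u) \<and>
     (\<forall>\<sigma> \<in> mor \<Gamma>. \<forall>x \<in> R \<sigma>. ident (R (rg \<Gamma> \<sigma>)) * x = x \<and> x * ident (R (dm \<Gamma> \<sigma>)) = x)"

definition part :: "('g \<Rightarrow> 'r::ring set) \<Rightarrow> 'g set \<Rightarrow> 'r set" where
  "part R X = {\<Sum>\<sigma>\<in>F. h \<sigma> | F h. finite F \<and> F \<subseteq> X \<and> (\<forall>\<sigma>\<in>F. h \<sigma> \<in> R \<sigma>)}"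


section \<open>The relative trace\<close>

text \<open>
  \<open>v\<close> is indexed by the degree of its values: the summands of \<open>\<gamma>\<^sub>\<sigma>\<close> pair
  \<open>u \<sigma> i\<close> with \<open>v (ginv \<Gamma> \<sigma>) i\<close>.
\<close>

definition unit_decomposition ::
    "'g cat \<Rightarrow> ('g \<Rightarrow> 'r::ring set) \<Rightarrow> ('g \<Rightarrow> nat) \<Rightarrow> ('g \<Rightarrow> nat \<Rightarrow> 'r) \<Rightarrow> ('g \<Rightarrow> nat \<Rightarrow> 'r) \<Rightarrow> bool" where
  "unit_decomposition \<Gamma> R n u v \<longleftrightarrow>
     (\<forall>\<sigma> \<in> mor \<Gamma>. n \<sigma> \<ge> 1 \<and>
        (\<forall>i \<in> {1..n \<sigma>}. u \<sigma> i \<in> R \<sigma> \<and> v (ginv \<Gamma> \<sigma>) i \<in> R (ginv \<Gamma> \<sigma>)) \<and>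
        (\<Sum>i=1..n \<sigma>. u \<sigma> i * v (ginv \<Gamma> \<sigma>) i) = ident (R (rg \<Gamma> \<sigma>)))"

definition gamma ::
    "'g cat \<Rightarrow> ('g \<Rightarrow> nat) \<Rightarrow> ('g \<Rightarrow> nat \<Rightarrow> 'r::ring) \<Rightarrow> ('g \<Rightarrow> nat \<Rightarrow> 'r) \<Rightarrow> 'g \<Rightarrow> 'r \<Rightarrow> 'r" where
  "gamma \<Gamma> n u v \<sigma> x = (\<Sum>i=1..n \<sigma>. u \<sigma> i * x * v (ginv \<Gamma> \<sigma>) i)"

text \<open>
  \<open>fin_obj \<Gamma> \<Delta>\<close> may be infinite, and \<open>sum\<close> is 0 on infinite sets, so the outer sum is restricted
  to the nonzero terms, which are finitely many for each \<open>x\<close>. The inner sums are finite because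
  \<open>hom_set \<Gamma> T f e\<close> has at most as many elements as there are cosets in the definition of
  \<open>fin_obj\<close>.
\<close>

definition rel_trace ::
    "'g cat \<Rightarrow> 'g set \<Rightarrow> 'g set \<Rightarrow> ('g \<Rightarrow> nat) \<Rightarrow> ('g \<Rightarrow> nat \<Rightarrow> 'r::ring) \<Rightarrow> ('g \<Rightarrow> nat \<Rightarrow> 'r) \<Rightarrow>
      'g \<Rightarrow> 'r \<Rightarrow> 'r" where
  "rel_trace \<Gamma> \<Delta> T n u v e x =
     (let t = (\<lambda>f. \<Sum>\<tau> \<in> hom_set \<Gamma> T f e. gamma \<Gamma> n u v \<tau> x)
      in \<Sum>f \<in> {f \<in> fin_obj \<Gamma> \<Delta>. t f \<noteq> 0}. t f)"


section \<open>Separable ring extensions\<close>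

text \<open>
  \<open>R \<otimes>\<^sub>S R\<close> is the free abelian group on \<open>R \<times> R\<close> modulo biadditivity and \<open>S\<close>-balancedness. Its
  elements are cosets, and maps out of it are induced by maps on the free abelian group.
\<close>

definition tensor_relators :: "'r::ring set \<Rightarrow> (('r \<times> 'r) \<Rightarrow>\<^sub>0 int) set" where
  "tensor_relators S =
     {frag_of (x + x', y) - frag_of (x, y) - frag_of (x', y) | x x' y. True} \<union>
     {frag_of (x, y + y') - frag_of (x, y) - frag_of (x, y') | x y y'. True} \<union>
     {frag_of (x * s, y) - frag_of (x, s * y) | x s y. s \<in> S}"

definition tensor_kernel :: "'r::ring set \<Rightarrow> (('r \<times> 'r) \<Rightarrow>\<^sub>0 int) set" where
  "tensor_kernel S = generate (free_Abelian_group UNIV) (tensor_relators S)"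

definition tensor_square :: "'r::ring set \<Rightarrow> (('r \<times> 'r) \<Rightarrow>\<^sub>0 int) set monoid" where
  "tensor_square S = free_Abelian_group UNIV Mod tensor_kernel S"

text \<open>
  The bimodule structure \<open>a (x \<otimes> y) = (a x) \<otimes> y\<close> and \<open>(x \<otimes> y) a = x \<otimes> (y a)\<close>. The image of
  a coset under the map on representatives need not be a full coset, whence the product with
  the kernel.
\<close>

definition tensor_lact :: "'r::ring set \<Rightarrow> 'r \<Rightarrow> (('r \<times> 'r) \<Rightarrow>\<^sub>0 int) set \<Rightarrow> (('r \<times> 'r) \<Rightarrow>\<^sub>0 int) set" where
  "tensor_lact S a C =
     tensor_kernel S <#>\<^bsub>free_Abelian_group UNIV\<^esub> frag_extend (\<lambda>(x, y). frag_of (a * x, y)) ` C"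

definition tensor_ract :: "'r::ring set \<Rightarrow> (('r \<times> 'r) \<Rightarrow>\<^sub>0 int) set \<Rightarrow> 'r \<Rightarrow> (('r \<times> 'r) \<Rightarrow>\<^sub>0 int) set" where
  "tensor_ract S C a =
     tensor_kernel S <#>\<^bsub>free_Abelian_group UNIV\<^esub> frag_extend (\<lambda>(x, y). frag_of (x, y * a)) ` C"

definition additive_group :: "'r::ring monoid" where
  "additive_group = \<lparr>carrier = UNIV, mult = (+), one = 0\<rparr>"

text \<open>
  In \<open>additive_group\<close> the power \<open>[^]\<close> with an integer exponent is the integer multiple.
\<close>

definition mult_free :: "(('r::ring \<times> 'r) \<Rightarrow>\<^sub>0 int) \<Rightarrow> 'r" where
  "mult_free c = (\<Sum>(x, y) \<in> Poly_Mapping.keys c.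
     (x * y) [^]\<^bsub>additive_group\<^esub> Poly_Mapping.lookup c (x, y))"

definition tensor_mult :: "(('r::ring \<times> 'r) \<Rightarrow>\<^sub>0 int) set \<Rightarrow> 'r" where
  "tensor_mult C = the_elem (mult_free ` C)"

definition bimodule_hom_to_tensor :: "'r::ring set \<Rightarrow> ('r \<Rightarrow> (('r \<times> 'r) \<Rightarrow>\<^sub>0 int) set) \<Rightarrow> bool" where
  "bimodule_hom_to_tensor S \<delta> \<longleftrightarrow>
     \<delta> \<in> hom additive_group (tensor_square S) \<and>
     (\<forall>a x. \<delta> (a * x) = tensor_lact S a (\<delta> x)) \<and>
     (\<forall>a x. \<delta> (x * a) = tensor_ract S (\<delta> x) a)"

definition separable_extension :: "'r::ring set \<Rightarrow> bool" where
  "separable_extension S \<longleftrightarrow> is_subring S \<and>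
     (\<exists>\<delta>. bimodule_hom_to_tensor S \<delta> \<and> (\<forall>x. tensor_mult (\<delta> x) = x))"

end

theory Submission
  imports Defs
begin

text \<open>
  A section \<open>\<delta>\<close> of the multiplication map amounts to elements \<open>X\<^sub>e = \<delta>(1\<^sub>e)\<close> of the tensor square with
  \<open>\<mu>(X\<^sub>e) = 1\<^sub>e\<close> and \<open>a X\<^sub>e = X\<^sub>f a\<close> for \<open>a\<close> homogeneous of degree \<open>e \<rightarrow> f\<close>.

  Given \<open>r\<close> as in the trace condition, \<open>X\<^sub>e = \<Sum>\<^sub>\<tau> \<Sum>\<^sub>i u\<^sub>\<tau>\<^sub>i r \<otimes> v\<^sub>\<tau>\<^sub>i\<close> works, where \<open>\<tau>\<close> runs over the
  representatives with range \<open>e\<close> whose domain has finite index and carries a nonzero component of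
  \<open>r\<close>, so that the sum is finite: left
  multiplication by \<open>a\<close> permutes the cosets \<open>\<tau>\<Lambda>\<close>, and the coefficients that appear lie in
  \<open>R\<^sub>\<Lambda>\<close>, so they commute with \<open>r\<close> and pass through the tensor sign.

  Conversely, for a morphism \<open>\<tau>\<close> with range \<open>e\<close> let \<open>c(\<tau>)\<close> be the degree \<open>e\<close> part of the image of
  \<open>X\<^sub>e\<close> under \<open>x \<otimes> y \<mapsto> p(x) y\<close>, where \<open>p\<close> projects onto the degrees in \<open>\<tau>\<Delta>\<close>. Then
  \<open>a c(\<tau>) = c(\<rho>\<tau>) a\<close> for \<open>a\<close> of degree \<open>\<rho>\<close>. Hence \<open>c(f)\<close> commutes with \<open>R\<^sub>\<Lambda>\<close> for every object
  \<open>f\<close>, and \<open>\<gamma>\<^sub>\<tau>\<close> sends \<open>c(f)\<close> to \<open>c(\<tau>)\<close> if \<open>f\<close> is the domain of \<open>\<tau>\<close>. The \<open>c(\<tau>)\<close> sum to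
  \<open>1\<^sub>e\<close> over the cosets of \<open>\<Delta>\<close> with range \<open>e\<close>, and almost all of them vanish; so \<open>r\<close> can be taken to
  be the sum of \<open>c(f)\<close> over one object \<open>f\<close> from each \<open>\<Delta>\<close>-component.
\<close>

section \<open>The tensor square modulo relators\<close>

lemma zero_in_tensor_kernel: "0 \<in> tensor_kernel S"
  unfolding tensor_kernel_def using generate.one[of "free_Abelian_group UNIV"] by simp

lemma add_in_tensor_kernel: "c \<in> tensor_kernel S \<Longrightarrow> d \<in> tensor_kernel S \<Longrightarrow> c + d \<in> tensor_kernel S"
  unfolding tensor_kernel_def using generate.eng[of c "free_Abelian_group UNIV" _ d] by simp

lemma uminus_in_tensor_kernel:
  assumes "c \<in> tensor_kernel S" shows "- c \<in> tensor_kernel S"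
  using group.generate_m_inv_closed[OF group_free_Abelian_group, of "tensor_relators S" UNIV c] assms
  unfolding tensor_kernel_def by (simp add: subset_iff)

lemma tensor_kernel_induct [consumes 1, case_names rel zero minus add]:
  assumes "c \<in> tensor_kernel S"
    and rel: "\<And>c. c \<in> tensor_relators S \<Longrightarrow> P c" and zero: "P 0"
    and minus: "\<And>c. P c \<Longrightarrow> P (- c)" and add: "\<And>c d. P c \<Longrightarrow> P d \<Longrightarrow> P (c + d)"
  shows "P c"
  using assms(1) unfolding tensor_kernel_def
  by (induction rule: generate.induct) (auto intro: rel zero minus add)

lemma tensor_relators_intros:
  "frag_of (x + x', y) - frag_of (x, y) - frag_of (x', y) \<in> tensor_relators S"
  "frag_of (x, y + y') - frag_of (x, y) - frag_of (x, y') \<in> tensor_relators S"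
  "s \<in> S \<Longrightarrow> frag_of (x * s, y) - frag_of (x, s * y) \<in> tensor_relators S"
  unfolding tensor_relators_def by blast+

lemma tensor_relators_cases:
  assumes "c \<in> tensor_relators S"
  obtains x x' y where "c = frag_of (x + x', y) - frag_of (x, y) - frag_of (x', y)"
  | x y y' where "c = frag_of (x, y + y') - frag_of (x, y) - frag_of (x, y')"
  | x s y where "s \<in> S" "c = frag_of (x * s, y) - frag_of (x, s * y)"
  using assms unfolding tensor_relators_def by blast

text \<open>Formal sums arise from \<open>0\<close> and single pairs by differences, so identities
  between additive maps need checking on single pairs only.\<close>

lemma frag_pair_induct [case_names zero one diff]:
  assumes "P 0" "\<And>x y. P (frag_of (x, y))" "\<And>a b. P a \<Longrightarrow> P b \<Longrightarrow> P (a - b)"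
  shows "P c"
  by (rule frag_induction[of c UNIV]) (use assms in auto)

text \<open>Equality of the elements of \<open>R \<otimes>\<^sub>S R\<close> that two formal sums
  represent. The proof computes with representatives; cosets appear only on the way to
  \<open>separable_extension_iff\<close>.\<close>

definition tensor_cong ::
    "'r::ring set \<Rightarrow> (('r \<times> 'r) \<Rightarrow>\<^sub>0 int) \<Rightarrow> (('r \<times> 'r) \<Rightarrow>\<^sub>0 int) \<Rightarrow> bool" where
  "tensor_cong S c d \<longleftrightarrow> c - d \<in> tensor_kernel S"

lemma tensor_cong_refl [simp]: "tensor_cong S c c"
  by (simp add: tensor_cong_def zero_in_tensor_kernel)

lemma tensor_cong_sym: "tensor_cong S c d \<Longrightarrow> tensor_cong S d c"
  unfolding tensor_cong_def using uminus_in_tensor_kernel[of "c - d"] by simp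

lemma tensor_cong_trans [trans]: "tensor_cong S c d \<Longrightarrow> tensor_cong S d e \<Longrightarrow> tensor_cong S c e"
  unfolding tensor_cong_def using add_in_tensor_kernel[of "c - d" S "d - e"] by simp

lemma tensor_cong_add:
  "tensor_cong S c d \<Longrightarrow> tensor_cong S c' d' \<Longrightarrow> tensor_cong S (c + c') (d + d')"
  unfolding tensor_cong_def using add_in_tensor_kernel[of "c - d" S "c' - d'"]
  by (simp add: algebra_simps)

lemma tensor_cong_sum:
  "(\<And>i. i \<in> I \<Longrightarrow> tensor_cong S (c i) (d i)) \<Longrightarrow> tensor_cong S (sum c I) (sum d I)"
  by (induction I rule: infinite_finite_induct) (auto intro: tensor_cong_add)

lemma tensor_cong_relator:
  "c \<in> tensor_relators S \<Longrightarrow> tensor_cong S c 0"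
  unfolding tensor_cong_def tensor_kernel_def by (auto intro: generate.incl)

lemma tensor_cong_iff_diff: "tensor_cong S c d \<longleftrightarrow> tensor_cong S (c - d) 0"
  by (simp add: tensor_cong_def)

lemma tensor_cong_add_left:
  "tensor_cong S (frag_of (x + x', y)) (frag_of (x, y) + frag_of (x', y))"
  unfolding tensor_cong_iff_diff[of _ _ "_ + _"] diff_diff_eq[symmetric]
  by (intro tensor_cong_relator tensor_relators_intros)

lemma tensor_cong_add_right:
  "tensor_cong S (frag_of (x, y + y')) (frag_of (x, y) + frag_of (x, y'))"
  unfolding tensor_cong_iff_diff[of _ _ "_ + _"] diff_diff_eq[symmetric]
  by (intro tensor_cong_relator tensor_relators_intros)

lemma tensor_cong_balanced:
  "s \<in> S \<Longrightarrow> tensor_cong S (frag_of (x * s, y)) (frag_of (x, s * y))"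
  unfolding tensor_cong_iff_diff[of _ "frag_of (x * s, y)"]
  by (intro tensor_cong_relator tensor_relators_intros)

text \<open>Additivity at \<open>0 + 0\<close> gives
  \<open>0 \<otimes> y = 0 \<otimes> y + 0 \<otimes> y\<close>, and one copy cancels.\<close>

lemma tensor_cong_zero_left: "tensor_cong S (frag_of (0, y)) 0"
  using tensor_cong_sym[OF tensor_cong_add_left[of S 0 0 y]] by (simp add: tensor_cong_def)

lemma tensor_cong_zero_right: "tensor_cong S (frag_of (x, 0)) 0"
  using tensor_cong_sym[OF tensor_cong_add_right[of S x 0 0]] by (simp add: tensor_cong_def)

lemma tensor_cong_sum_left:
  "tensor_cong S (frag_of (sum f I, y)) (\<Sum>i\<in>I. frag_of (f i, y))"
proof (induction I rule: infinite_finite_induct)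
  case (insert i I)
  then show ?case
    using tensor_cong_trans[OF tensor_cong_add_left tensor_cong_add[OF tensor_cong_refl insert.IH]]
    by simp
qed (auto intro: tensor_cong_zero_left)

lemma tensor_cong_sum_right:
  "tensor_cong S (frag_of (x, sum f I)) (\<Sum>i\<in>I. frag_of (x, f i))"
proof (induction I rule: infinite_finite_induct)
  case (insert i I)
  then show ?case
    using tensor_cong_trans[OF tensor_cong_add_right tensor_cong_add[OF tensor_cong_refl insert.IH]]
    by simp
qed (auto intro: tensor_cong_zero_right)

section \<open>Left and right multiplication on formal sums\<close>

definition frag_lmul :: "'r::ring \<Rightarrow> (('r \<times> 'r) \<Rightarrow>\<^sub>0 int) \<Rightarrow> (('r \<times> 'r) \<Rightarrow>\<^sub>0 int)" where
  "frag_lmul a = frag_extend (\<lambda>(x, y). frag_of (a * x, y))"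

definition frag_rmul :: "(('r::ring \<times> 'r) \<Rightarrow>\<^sub>0 int) \<Rightarrow> 'r \<Rightarrow> (('r \<times> 'r) \<Rightarrow>\<^sub>0 int)" where
  "frag_rmul c a = frag_extend (\<lambda>(x, y). frag_of (x, y * a)) c"

lemma frag_lmul_simps [simp]:
  "frag_lmul a (frag_of (x, y)) = frag_of (a * x, y)" "frag_lmul a 0 = 0"
  "frag_lmul a (c + d) = frag_lmul a c + frag_lmul a d"
  "frag_lmul a (c - d) = frag_lmul a c - frag_lmul a d"
  "frag_lmul a (- c) = - frag_lmul a c"
  by (simp_all add: frag_lmul_def frag_extend_add frag_extend_diff frag_extend_minus)

lemma frag_rmul_simps [simp]:
  "frag_rmul (frag_of (x, y)) a = frag_of (x, y * a)" "frag_rmul 0 a = 0"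
  "frag_rmul (c + d) a = frag_rmul c a + frag_rmul d a"
  "frag_rmul (c - d) a = frag_rmul c a - frag_rmul d a"
  "frag_rmul (- c) a = - frag_rmul c a"
  by (simp_all add: frag_rmul_def frag_extend_add frag_extend_diff frag_extend_minus)

lemma frag_lmul_sum: "frag_lmul a (sum c I) = (\<Sum>i\<in>I. frag_lmul a (c i))"
  by (induction I rule: infinite_finite_induct) auto

lemma frag_rmul_sum: "frag_rmul (sum c I) a = (\<Sum>i\<in>I. frag_rmul (c i) a)"
  by (induction I rule: infinite_finite_induct) auto

text \<open>Each relator goes to a relator of the same kind: in the balancing relation
  \<open>s\<close> stands to the right of the first factor, and associativity keeps it
  there.\<close>

lemma frag_lmul_kernel: "c \<in> tensor_kernel S \<Longrightarrow> frag_lmul a c \<in> tensor_kernel S"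
proof (induction rule: tensor_kernel_induct)
  case (rel c)
  then have "frag_lmul a c \<in> tensor_relators S"
    by (cases rule: tensor_relators_cases)
      (auto simp: distrib_left mult.assoc[symmetric] intro: tensor_relators_intros)
  then show ?case
    unfolding tensor_kernel_def by (rule generate.incl)
qed (auto intro: zero_in_tensor_kernel add_in_tensor_kernel uminus_in_tensor_kernel)

lemma frag_rmul_kernel: "c \<in> tensor_kernel S \<Longrightarrow> frag_rmul c a \<in> tensor_kernel S"
proof (induction rule: tensor_kernel_induct)
  case (rel c)
  then have "frag_rmul c a \<in> tensor_relators S"
    by (cases rule: tensor_relators_cases)
      (auto simp: distrib_right mult.assoc intro: tensor_relators_intros)
  then show ?case
    unfolding tensor_kernel_def by (rule generate.incl)
qed (auto intro: zero_in_tensor_kernel add_in_tensor_kernel uminus_in_tensor_kernel)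

lemma frag_lmul_cong: "tensor_cong S c d \<Longrightarrow> tensor_cong S (frag_lmul a c) (frag_lmul a d)"
  unfolding tensor_cong_def by (metis frag_lmul_kernel frag_lmul_simps(4))

lemma frag_rmul_cong: "tensor_cong S c d \<Longrightarrow> tensor_cong S (frag_rmul c a) (frag_rmul d a)"
  unfolding tensor_cong_def by (metis frag_rmul_kernel frag_rmul_simps(4))

lemma frag_lmul_lmul: "frag_lmul a (frag_lmul b c) = frag_lmul (a * b) c"
  by (induction c rule: frag_pair_induct) (auto simp: mult.assoc)

lemma frag_lmul_rmul: "frag_lmul a (frag_rmul c b) = frag_rmul (frag_lmul a c) b"
  by (induction c rule: frag_pair_induct) auto

text \<open>Only a congruence: \<open>(a + b) x \<otimes> y\<close> splits modulo an additivity
  relator, not as a formal sum.\<close>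

lemma frag_lmul_add_left: "tensor_cong S (frag_lmul (a + b) c) (frag_lmul a c + frag_lmul b c)"
proof (induction c rule: frag_pair_induct)
  case (diff c d)
  then have "tensor_cong S (frag_lmul (a + b) c - (frag_lmul a c + frag_lmul b c)) 0"
    "tensor_cong S (frag_lmul (a + b) d - (frag_lmul a d + frag_lmul b d)) 0"
    by (simp_all add: tensor_cong_def)
  from add_in_tensor_kernel[OF this(1)[unfolded tensor_cong_def]
      uminus_in_tensor_kernel[OF this(2)[unfolded tensor_cong_def]]]
  show ?case by (simp add: tensor_cong_def algebra_simps)
qed (auto simp: distrib_right intro: tensor_cong_add_left)

lemma frag_rmul_add_right: "tensor_cong S (frag_rmul c (a + b)) (frag_rmul c a + frag_rmul c b)"
proof (induction c rule: frag_pair_induct)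
  case (diff c d)
  then have "tensor_cong S (frag_rmul c (a + b) - (frag_rmul c a + frag_rmul c b)) 0"
    "tensor_cong S (frag_rmul d (a + b) - (frag_rmul d a + frag_rmul d b)) 0"
    by (simp_all add: tensor_cong_def)
  from add_in_tensor_kernel[OF this(1)[unfolded tensor_cong_def]
      uminus_in_tensor_kernel[OF this(2)[unfolded tensor_cong_def]]]
  show ?case by (simp add: tensor_cong_def algebra_simps)
qed (auto simp: distrib_left intro: tensor_cong_add_right)

section \<open>Additive extensions and the universal property of the tensor square\<close>

definition frag_lift :: "('r \<times> 'r \<Rightarrow> 'r::ring) \<Rightarrow> (('r \<times> 'r) \<Rightarrow>\<^sub>0 int) \<Rightarrow> 'r" where
  "frag_lift \<beta> c = (\<Sum>p \<in> Poly_Mapping.keys c. \<beta> p [^]\<^bsub>additive_group\<^esub> Poly_Mapping.lookup c p)"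

lemma mult_free_eq_frag_lift: "mult_free = frag_lift (\<lambda>(x, y). x * y)"
  by (auto simp: mult_free_def frag_lift_def intro!: sum.cong)

lemma group_additive_group: "group (additive_group :: 'r::ring monoid)"
proof (rule groupI)
  fix x :: 'r
  show "\<exists>y \<in> carrier additive_group. y \<otimes>\<^bsub>additive_group\<^esub> x = \<one>\<^bsub>additive_group\<^esub>"
    by (rule bexI[of _ "- x"]) (auto simp: additive_group_def)
qed (auto simp: additive_group_def add.assoc)

lemma additive_pow_add:
  "(x :: 'r::ring) [^]\<^bsub>additive_group\<^esub> (i + j :: int) = x [^]\<^bsub>additive_group\<^esub> i + x [^]\<^bsub>additive_group\<^esub> j"
  using group.int_pow_mult[OF group_additive_group, of x i j] by (simp add: additive_group_def)

lemma one_additive_group [simp]: "\<one>\<^bsub>additive_group\<^esub> = 0"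
  by (simp add: additive_group_def)

lemma additive_pow_1: "(x :: 'r::ring) [^]\<^bsub>additive_group\<^esub> (1 :: int) = x"
  using group.int_pow_1[OF group_additive_group, of x] by (simp add: additive_group_def)

text \<open>Pairs that are not keys of \<open>c\<close> have exponent 0 and contribute 0. A common
  index set for two formal sums makes their coefficients addable.\<close>

lemma frag_lift_superset:
  assumes "finite A" "Poly_Mapping.keys c \<subseteq> A"
  shows "frag_lift \<beta> c = (\<Sum>p \<in> A. \<beta> p [^]\<^bsub>additive_group\<^esub> Poly_Mapping.lookup c p)"
  unfolding frag_lift_def using assms
  by (intro sum.mono_neutral_left) (auto simp: in_keys_iff)

lemma frag_lift_add: "frag_lift \<beta> (c + d) = frag_lift \<beta> c + frag_lift \<beta> d"
proof -
  have "finite (Poly_Mapping.keys c \<union> Poly_Mapping.keys d)" by simp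
  then show ?thesis
    using keys_add[of c d]
    by (simp add: frag_lift_superset[of "Poly_Mapping.keys c \<union> Poly_Mapping.keys d"]
        lookup_add additive_pow_add sum.distrib)
qed

lemma frag_lift_0 [simp]: "frag_lift \<beta> 0 = 0"
  by (simp add: frag_lift_def)

lemma frag_lift_of [simp]: "frag_lift \<beta> (frag_of p) = \<beta> p"
  by (simp add: frag_lift_def additive_pow_1)

lemma frag_lift_minus: "frag_lift \<beta> (- c) = - frag_lift \<beta> c"
  using frag_lift_add[of \<beta> c "- c"] by (simp add: minus_unique)

lemma frag_lift_diff: "frag_lift \<beta> (c - d) = frag_lift \<beta> c - frag_lift \<beta> d"
  using frag_lift_add[of \<beta> c "- d"] by (simp add: frag_lift_minus)

lemma frag_lift_sum: "frag_lift \<beta> (sum c I) = (\<Sum>i\<in>I. frag_lift \<beta> (c i))"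
  by (induction I rule: infinite_finite_induct) (auto simp: frag_lift_add)

lemma frag_lift_frag_lmul: "frag_lift \<beta> (frag_lmul a c) = frag_lift (\<lambda>(x, y). \<beta> (a * x, y)) c"
  by (induction c rule: frag_pair_induct) (auto simp: frag_lift_diff)

lemma frag_lift_frag_rmul: "frag_lift \<beta> (frag_rmul c a) = frag_lift (\<lambda>(x, y). \<beta> (x, y * a)) c"
  by (induction c rule: frag_pair_induct) (auto simp: frag_lift_diff)

lemma frag_lift_mult_left: "a * frag_lift \<beta> c = frag_lift (\<lambda>p. a * \<beta> p) c"
  by (induction c rule: frag_pair_induct) (auto simp: frag_lift_diff right_diff_distrib)

lemma frag_lift_mult_right: "frag_lift \<beta> c * a = frag_lift (\<lambda>p. \<beta> p * a) c"
  by (induction c rule: frag_pair_induct) (auto simp: frag_lift_diff left_diff_distrib)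

lemma frag_lift_zero_fun: "frag_lift (\<lambda>_. 0) c = 0"
  by (induction c rule: frag_pair_induct) (auto simp: frag_lift_diff)

lemma frag_lift_add_fun: "frag_lift (\<lambda>p. \<beta> p + \<beta>' p) c = frag_lift \<beta> c + frag_lift \<beta>' c"
  by (induction c rule: frag_pair_induct) (auto simp: frag_lift_diff)

lemma frag_lift_cong_keys:
  "(\<And>p. p \<in> Poly_Mapping.keys c \<Longrightarrow> \<beta> p = \<beta>' p) \<Longrightarrow> frag_lift \<beta> c = frag_lift \<beta>' c"
  by (simp add: frag_lift_def)

text \<open>The universal property: a biadditive, \<open>S\<close>-balanced map vanishes on the
  three kinds of relators, so its additive extension vanishes on the subgroup that they
  generate.\<close>

lemma frag_lift_kernel:
  assumes "c \<in> tensor_kernel S"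
    and "\<And>x x' y. \<beta> (x + x', y) = \<beta> (x, y) + \<beta> (x', y)"
    and "\<And>x y y'. \<beta> (x, y + y') = \<beta> (x, y) + \<beta> (x, y')"
    and "\<And>x s y. s \<in> S \<Longrightarrow> \<beta> (x * s, y) = \<beta> (x, s * y)"
  shows "frag_lift \<beta> c = 0"
  using assms(1)
proof (induction rule: tensor_kernel_induct)
  case (rel c)
  then show ?case
    by (cases rule: tensor_relators_cases) (auto simp: frag_lift_diff assms(2-4))
qed (auto simp: frag_lift_minus frag_lift_add)

lemma frag_lift_tensor_cong:
  assumes "tensor_cong S c d"
    and "\<And>x x' y. \<beta> (x + x', y) = \<beta> (x, y) + \<beta> (x', y)"
    and "\<And>x y y'. \<beta> (x, y + y') = \<beta> (x, y) + \<beta> (x, y')"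
    and "\<And>x s y. s \<in> S \<Longrightarrow> \<beta> (x * s, y) = \<beta> (x, s * y)"
  shows "frag_lift \<beta> c = frag_lift \<beta> d"
  using frag_lift_kernel[OF assms(1)[unfolded tensor_cong_def], of \<beta>] assms(2-)
  by (simp add: frag_lift_diff)

lemma mult_free_tensor_cong: "tensor_cong S c d \<Longrightarrow> mult_free c = mult_free d"
  unfolding mult_free_eq_frag_lift
  by (rule frag_lift_tensor_cong) (auto simp: distrib_left distrib_right mult.assoc)

section \<open>From cosets to representatives\<close>

definition tensor_coset :: "'r::ring set \<Rightarrow> (('r \<times> 'r) \<Rightarrow>\<^sub>0 int) \<Rightarrow> (('r \<times> 'r) \<Rightarrow>\<^sub>0 int) set" where
  "tensor_coset S c = {d. tensor_cong S d c}"

lemma tensor_coset_eq_iff: "tensor_coset S c = tensor_coset S d \<longleftrightarrow> tensor_cong S c d"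
  unfolding tensor_coset_def by (blast intro: tensor_cong_refl tensor_cong_trans tensor_cong_sym)

lemma carrier_tensor_square: "carrier (tensor_square S) = range (tensor_coset S)"
proof -
  have "tensor_kernel S #>\<^bsub>free_Abelian_group UNIV\<^esub> c = tensor_coset S c" for c
    unfolding tensor_coset_def tensor_cong_def r_coset_def
    by (auto intro!: bexI[of _ "_ - c"])
  moreover have "carrier (free_Abelian_group (UNIV :: ('a \<times> 'a) set)) = UNIV" by auto
  ultimately show ?thesis
    by (simp add: tensor_square_def carrier_FactGroup)
qed

lemma in_set_mult_free_Abelian_group:
  "x \<in> A <#>\<^bsub>free_Abelian_group UNIV\<^esub> B \<longleftrightarrow> (\<exists>a\<in>A. \<exists>b\<in>B. x = a + b)"
  by (simp add: set_mult_def)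

lemma mult_tensor_square:
  "tensor_coset S c \<otimes>\<^bsub>tensor_square S\<^esub> tensor_coset S d = tensor_coset S (c + d)"
proof -
  have "x \<in> tensor_coset S c <#>\<^bsub>free_Abelian_group UNIV\<^esub> tensor_coset S d \<longleftrightarrow>
      x \<in> tensor_coset S (c + d)" for x
  proof
    assume "x \<in> tensor_coset S (c + d)"
    then have "x - d \<in> tensor_coset S c"
      by (simp add: tensor_coset_def tensor_cong_def diff_diff_eq add.commute)
    moreover have "d \<in> tensor_coset S d" by (simp add: tensor_coset_def)
    ultimately show "x \<in> tensor_coset S c <#>\<^bsub>free_Abelian_group UNIV\<^esub> tensor_coset S d"
      unfolding in_set_mult_free_Abelian_group by (metis diff_add_cancel)
  next
    assume "x \<in> tensor_coset S c <#>\<^bsub>free_Abelian_group UNIV\<^esub> tensor_coset S d"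
    then show "x \<in> tensor_coset S (c + d)"
      unfolding in_set_mult_free_Abelian_group tensor_coset_def by (blast intro: tensor_cong_add)
  qed
  then show ?thesis
    by (simp add: tensor_square_def set_eq_iff)
qed

text \<open>The image of a class under \<open>f\<close> may be a proper subset of a class. Adding
  the kernel fills it up, because any \<open>x\<close> congruent to \<open>f c\<close> is
  \<open>(x - f c) + f c\<close>.\<close>

lemma tensor_kernel_set_mult_image:
  assumes f: "\<And>c d. tensor_cong S c d \<Longrightarrow> tensor_cong S (f c) (f d)"
  shows "tensor_kernel S <#>\<^bsub>free_Abelian_group UNIV\<^esub> f ` tensor_coset S c = tensor_coset S (f c)"
proof (intro Set.set_eqI)
  fix x
  have "tensor_cong S (k + f d) (f c)" if "k \<in> tensor_kernel S" "tensor_cong S d c" for k d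
    using tensor_cong_add[OF _ f[OF that(2)], of k 0] that(1) by (simp add: tensor_cong_def)
  moreover have "\<exists>k\<in>tensor_kernel S. \<exists>d. tensor_cong S d c \<and> x = k + f d"
    if "tensor_cong S x (f c)"
    using that by (intro bexI[of _ "x - f c"] exI[of _ c]) (simp_all add: tensor_cong_def[of S x])
  ultimately show "x \<in> tensor_kernel S <#>\<^bsub>free_Abelian_group UNIV\<^esub> f ` tensor_coset S c \<longleftrightarrow>
      x \<in> tensor_coset S (f c)"
    unfolding in_set_mult_free_Abelian_group tensor_coset_def by blast
qed

lemma tensor_lact_coset: "tensor_lact S a (tensor_coset S c) = tensor_coset S (frag_lmul a c)"
  unfolding tensor_lact_def frag_lmul_def[symmetric]
  by (rule tensor_kernel_set_mult_image) (rule frag_lmul_cong)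

lemma tensor_ract_coset: "tensor_ract S (tensor_coset S c) a = tensor_coset S (frag_rmul c a)"
  unfolding tensor_ract_def frag_rmul_def[symmetric]
  by (rule tensor_kernel_set_mult_image) (rule frag_rmul_cong)

text \<open>\<open>mult_free\<close> is constant on a class, so \<open>the_elem\<close> returns the
  common value.\<close>

lemma tensor_mult_coset: "tensor_mult (tensor_coset S c) = mult_free c"
proof -
  have "c \<in> tensor_coset S c" "\<And>d. d \<in> tensor_coset S c \<Longrightarrow> mult_free d = mult_free c"
    by (auto simp: tensor_coset_def dest: mult_free_tensor_cong)
  then have "mult_free ` tensor_coset S c = {mult_free c}" by blast
  then show ?thesis by (simp add: tensor_mult_def)
qed

text \<open>A section is traded for a choice \<open>D\<close> of representatives of its values. The
  homomorphism laws then hold up to congruence, while the condition on \<open>mult_free\<close>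
  stays an equation, since \<open>mult_free\<close> respects congruence.\<close>

lemma separable_extension_iff:
  "separable_extension S \<longleftrightarrow> is_subring S \<and>
    (\<exists>D. (\<forall>x y. tensor_cong S (D (x + y)) (D x + D y)) \<and>
         (\<forall>a x. tensor_cong S (D (a * x)) (frag_lmul a (D x))) \<and>
         (\<forall>a x. tensor_cong S (D (x * a)) (frag_rmul (D x) a)) \<and>
         (\<forall>x. mult_free (D x) = x))"
  (is "_ \<longleftrightarrow> _ \<and> (\<exists>D. ?P D)")
proof -
  have hom_iff: "\<delta> \<in> hom additive_group (tensor_square S) \<longleftrightarrow>
      (\<forall>x. \<delta> x \<in> range (tensor_coset S)) \<and>
      (\<forall>x y. \<delta> (x + y) = \<delta> x \<otimes>\<^bsub>tensor_square S\<^esub> \<delta> y)" for \<delta>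
    unfolding hom_def carrier_tensor_square by (simp add: additive_group_def Pi_def)
  have bim: "bimodule_hom_to_tensor S (\<lambda>x. tensor_coset S (D x)) \<and>
      (\<forall>x. tensor_mult (tensor_coset S (D x)) = x) \<longleftrightarrow> ?P D" for D
    by (simp only: bimodule_hom_to_tensor_def hom_iff mult_tensor_square tensor_lact_coset
      tensor_ract_coset tensor_mult_coset tensor_coset_eq_iff rangeI simp_thms conj_assoc)
  have "\<exists>D. ?P D" if \<delta>: "bimodule_hom_to_tensor S \<delta>" "\<forall>x. tensor_mult (\<delta> x) = x" for \<delta>
  proof -
    have "\<forall>x. \<exists>c. \<delta> x = tensor_coset S c"
      using \<delta>(1) unfolding bimodule_hom_to_tensor_def hom_iff image_iff bex_UNIV by (elim conjE)
    then obtain D where "\<forall>x. \<delta> x = tensor_coset S (D x)"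
      by (rule choice[THEN exE])
    then have "\<delta> = (\<lambda>x. tensor_coset S (D x))" by (intro ext) (rule spec)
    with \<delta> have "?P D" by (intro bim[THEN iffD1] conjI) (simp_all only: simp_thms)
    then show ?thesis by (rule exI[of _ D])
  qed
  moreover have "\<exists>\<delta>. bimodule_hom_to_tensor S \<delta> \<and> (\<forall>x. tensor_mult (\<delta> x) = x)" if "?P D" for D
    using bim[of D, THEN iffD2, OF that] by (rule exI[of _ "\<lambda>x. tensor_coset S (D x)"])
  ultimately show ?thesis
    unfolding separable_extension_def by (intro conj_cong refl iffI; elim exE conjE) simp_all
qed

section \<open>Homogeneous components\<close>

lemma (in category) comp_obj_right: "\<sigma> \<in> mor \<Gamma> \<Longrightarrow> dm \<Gamma> \<sigma> = e \<Longrightarrow> comp \<Gamma> \<sigma> e = \<sigma>"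
  using comp_dm by blast

lemma (in category) comp_obj_left: "\<sigma> \<in> mor \<Gamma> \<Longrightarrow> rg \<Gamma> \<sigma> = e \<Longrightarrow> comp \<Gamma> e \<sigma> = \<sigma>"
  using comp_rg by blast

text \<open>\<open>comp_obj_right\<close> and \<open>comp_obj_left\<close> replace
  \<open>comp_dm\<close> and \<open>comp_rg\<close>, so that an identity cancels even when only a
  hypothesis equates it with a domain or range.\<close>

lemmas (in category) category_simps [simp] =
  dm_mor rg_mor dm_dm rg_dm dm_rg rg_rg comp_mor dm_comp rg_comp comp_obj_right comp_obj_left comp_assoc

lemma (in category) obj_iff: "e \<in> obj \<Gamma> (mor \<Gamma>) \<longleftrightarrow> e \<in> mor \<Gamma> \<and> dm \<Gamma> e = e"
proof
  assume "e \<in> mor \<Gamma> \<and> dm \<Gamma> e = e"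
  then show "e \<in> obj \<Gamma> (mor \<Gamma>)" unfolding obj_def by (intro image_eqI[of _ _ e]) auto
qed (auto simp: obj_def)

lemma (in category) obj_simps:
  assumes "e \<in> obj \<Gamma> (mor \<Gamma>)"
  shows "e \<in> mor \<Gamma>" "dm \<Gamma> e = e" "rg \<Gamma> e = e"
  using assms rg_dm[of e] by (auto simp: obj_iff)

lemma (in category) dm_obj: "\<sigma> \<in> mor \<Gamma> \<Longrightarrow> dm \<Gamma> \<sigma> \<in> obj \<Gamma> (mor \<Gamma>)"
  by (simp add: obj_iff)

lemma (in category) rg_obj: "\<sigma> \<in> mor \<Gamma> \<Longrightarrow> rg \<Gamma> \<sigma> \<in> obj \<Gamma> (mor \<Gamma>)"
  by (simp add: obj_iff)

context groupoid
begin

lemma is_inverse_unique: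
  assumes "\<sigma> \<in> mor \<Gamma>" "is_inverse \<Gamma> \<sigma> \<tau>" "is_inverse \<Gamma> \<sigma> \<tau>'"
  shows "\<tau> = \<tau>'"
proof -
  have "comp \<Gamma> (comp \<Gamma> \<tau> \<sigma>) \<tau>' = comp \<Gamma> \<tau> (comp \<Gamma> \<sigma> \<tau>')"
    using assms unfolding is_inverse_def by (intro comp_assoc) auto
  then show ?thesis
    using assms unfolding is_inverse_def by (metis comp_obj_left comp_obj_right)
qed

lemma is_inverse_ginv: "\<sigma> \<in> mor \<Gamma> \<Longrightarrow> is_inverse \<Gamma> \<sigma> (ginv \<Gamma> \<sigma>)"
  unfolding ginv_def by (rule theI') (metis ex_inverse is_inverse_unique)

lemma ginv_eqI: "\<sigma> \<in> mor \<Gamma> \<Longrightarrow> is_inverse \<Gamma> \<sigma> \<tau> \<Longrightarrow> ginv \<Gamma> \<sigma> = \<tau>"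
  using is_inverse_unique is_inverse_ginv by blast

lemma ginv_simps [simp]:
  assumes "\<sigma> \<in> mor \<Gamma>"
  shows "ginv \<Gamma> \<sigma> \<in> mor \<Gamma>" "dm \<Gamma> (ginv \<Gamma> \<sigma>) = rg \<Gamma> \<sigma>" "rg \<Gamma> (ginv \<Gamma> \<sigma>) = dm \<Gamma> \<sigma>"
    "comp \<Gamma> \<sigma> (ginv \<Gamma> \<sigma>) = rg \<Gamma> \<sigma>" "comp \<Gamma> (ginv \<Gamma> \<sigma>) \<sigma> = dm \<Gamma> \<sigma>"
  using is_inverse_ginv[OF assms] unfolding is_inverse_def by auto

text \<open>The simplifier associates composites to the right, so cancellation is needed in this
  nested form.\<close>

lemma ginv_comp_cancel [simp]:
  assumes "\<sigma> \<in> mor \<Gamma>" "\<tau> \<in> mor \<Gamma>"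
  shows "dm \<Gamma> \<sigma> = rg \<Gamma> \<tau> \<Longrightarrow> comp \<Gamma> (ginv \<Gamma> \<sigma>) (comp \<Gamma> \<sigma> \<tau>) = \<tau>"
    "rg \<Gamma> \<sigma> = rg \<Gamma> \<tau> \<Longrightarrow> comp \<Gamma> \<sigma> (comp \<Gamma> (ginv \<Gamma> \<sigma>) \<tau>) = \<tau>"
  using assms comp_assoc[of "ginv \<Gamma> \<sigma>" \<sigma> \<tau>] comp_assoc[of \<sigma> "ginv \<Gamma> \<sigma>" \<tau>] by (simp_all del: comp_assoc)

lemma ginv_ginv [simp]: "\<sigma> \<in> mor \<Gamma> \<Longrightarrow> ginv \<Gamma> (ginv \<Gamma> \<sigma>) = \<sigma>"
  by (rule ginv_eqI) (auto simp: is_inverse_def)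

lemma ginv_comp [simp]:
  assumes "\<sigma> \<in> mor \<Gamma>" "\<tau> \<in> mor \<Gamma>" "dm \<Gamma> \<sigma> = rg \<Gamma> \<tau>"
  shows "ginv \<Gamma> (comp \<Gamma> \<sigma> \<tau>) = comp \<Gamma> (ginv \<Gamma> \<tau>) (ginv \<Gamma> \<sigma>)"
  using assms by (intro ginv_eqI) (auto simp: is_inverse_def)

lemma ginv_obj [simp]: "e \<in> obj \<Gamma> (mor \<Gamma>) \<Longrightarrow> ginv \<Gamma> e = e"
  by (rule ginv_eqI) (auto simp: is_inverse_def obj_simps)

lemma mem_obj_class:
  "f \<in> obj_class \<Gamma> e \<longleftrightarrow> (\<exists>\<sigma>\<in>mor \<Gamma>. dm \<Gamma> \<sigma> = e \<and> rg \<Gamma> \<sigma> = f)"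
  unfolding obj_class_def hom_set_def using rg_obj by auto

lemma obj_class_eq:
  assumes "\<sigma> \<in> mor \<Gamma>" shows "obj_class \<Gamma> (dm \<Gamma> \<sigma>) = obj_class \<Gamma> (rg \<Gamma> \<sigma>)"
proof -
  have "\<exists>\<rho>\<in>mor \<Gamma>. dm \<Gamma> \<rho> = rg \<Gamma> \<sigma> \<and> rg \<Gamma> \<rho> = f"
    if "\<tau> \<in> mor \<Gamma>" "dm \<Gamma> \<tau> = dm \<Gamma> \<sigma>" "rg \<Gamma> \<tau> = f" for f \<tau>
    using that assms by (intro bexI[of _ "comp \<Gamma> \<tau> (ginv \<Gamma> \<sigma>)"]) auto
  moreover have "\<exists>\<rho>\<in>mor \<Gamma>. dm \<Gamma> \<rho> = dm \<Gamma> \<sigma> \<and> rg \<Gamma> \<rho> = f"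
    if "\<tau> \<in> mor \<Gamma>" "dm \<Gamma> \<tau> = rg \<Gamma> \<sigma>" "rg \<Gamma> \<tau> = f" for f \<tau>
    using that assms by (intro bexI[of _ "comp \<Gamma> \<tau> \<sigma>"]) auto
  ultimately show ?thesis
    unfolding set_eq_subset subset_iff mem_obj_class by blast
qed

end

section \<open>Components in an object unital graded ring\<close>

locale object_unital_graded = groupoid \<Gamma> for \<Gamma> :: "'g cat" +
  fixes R :: "'g \<Rightarrow> 'r::ring set"
  assumes graded: "graded \<Gamma> R" and object_unital: "object_unital \<Gamma> R"
begin

lemma R_zero [simp]: "\<sigma> \<in> mor \<Gamma> \<Longrightarrow> 0 \<in> R \<sigma>"
  and R_diff: "\<sigma> \<in> mor \<Gamma> \<Longrightarrow> x \<in> R \<sigma> \<Longrightarrow> y \<in> R \<sigma> \<Longrightarrow> x - y \<in> R \<sigma>"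
  using graded unfolding graded_def additive_subgroup_def by blast+

lemma R_add: "\<sigma> \<in> mor \<Gamma> \<Longrightarrow> x \<in> R \<sigma> \<Longrightarrow> y \<in> R \<sigma> \<Longrightarrow> x + y \<in> R \<sigma>"
  using R_diff[of \<sigma> x "0 - y"] R_diff[of \<sigma> 0 y] by simp

lemma R_sum: "\<sigma> \<in> mor \<Gamma> \<Longrightarrow> (\<And>i. i \<in> I \<Longrightarrow> x i \<in> R \<sigma>) \<Longrightarrow> sum x I \<in> R \<sigma>"
  by (induction I rule: infinite_finite_induct) (auto intro: R_add)

lemma mult_sums_of_products: "x \<in> A \<Longrightarrow> y \<in> B \<Longrightarrow> x * y \<in> sums_of_products A B"
  unfolding sums_of_products_def
  by (intro CollectI exI[of _ "1::nat"] exI[of _ "\<lambda>_. x"] exI[of _ "\<lambda>_. y"]) auto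

lemma R_mult:
  assumes "\<sigma> \<in> mor \<Gamma>" "\<tau> \<in> mor \<Gamma>" "x \<in> R \<sigma>" "y \<in> R \<tau>"
  shows "dm \<Gamma> \<sigma> = rg \<Gamma> \<tau> \<Longrightarrow> x * y \<in> R (comp \<Gamma> \<sigma> \<tau>)"
    and "dm \<Gamma> \<sigma> \<noteq> rg \<Gamma> \<tau> \<Longrightarrow> x * y = 0"
proof -
  have *: "if dm \<Gamma> \<sigma> = rg \<Gamma> \<tau> then sums_of_products (R \<sigma>) (R \<tau>) \<subseteq> R (comp \<Gamma> \<sigma> \<tau>)
      else sums_of_products (R \<sigma>) (R \<tau>) = {0}"
    using graded assms(1,2) unfolding graded_def by blast
  then show "dm \<Gamma> \<sigma> = rg \<Gamma> \<tau> \<Longrightarrow> x * y \<in> R (comp \<Gamma> \<sigma> \<tau>)"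
    "dm \<Gamma> \<sigma> \<noteq> rg \<Gamma> \<tau> \<Longrightarrow> x * y = 0"
    using mult_sums_of_products[OF assms(3,4)] by auto
qed

lemma is_ident_ident: "e \<in> obj \<Gamma> (mor \<Gamma>) \<Longrightarrow> is_ident (R e) (ident (R e))"
  unfolding ident_def
proof (rule theI')
  assume "e \<in> obj \<Gamma> (mor \<Gamma>)"
  then obtain u where "is_ident (R e) u" using object_unital unfolding object_unital_def by blast
  then show "\<exists>!u. is_ident (R e) u" unfolding is_ident_def by metis
qed

lemma ident_in: "e \<in> obj \<Gamma> (mor \<Gamma>) \<Longrightarrow> ident (R e) \<in> R e"
  using is_ident_ident unfolding is_ident_def by blast

lemma ident_mult:
  "\<sigma> \<in> mor \<Gamma> \<Longrightarrow> x \<in> R \<sigma> \<Longrightarrow> rg \<Gamma> \<sigma> = e \<Longrightarrow> ident (R e) * x = x"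
  "\<sigma> \<in> mor \<Gamma> \<Longrightarrow> x \<in> R \<sigma> \<Longrightarrow> dm \<Gamma> \<sigma> = e \<Longrightarrow> x * ident (R e) = x"
  using object_unital unfolding object_unital_def by blast+

lemma ident_mult_zero:
  assumes "e \<in> obj \<Gamma> (mor \<Gamma>)" "\<sigma> \<in> mor \<Gamma>" "x \<in> R \<sigma>"
  shows "rg \<Gamma> \<sigma> \<noteq> e \<Longrightarrow> ident (R e) * x = 0" "dm \<Gamma> \<sigma> \<noteq> e \<Longrightarrow> x * ident (R e) = 0"
  using R_mult(2)[of e \<sigma> "ident (R e)" x] R_mult(2)[of \<sigma> e x "ident (R e)"] assms
    ident_in[of e] obj_simps[of e] by auto

text \<open>The predicate under the unique existence quantifier of \<open>graded\<close>, named so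
  that uniqueness can be applied to explicit families.\<close>

definition is_decomp :: "'r \<Rightarrow> ('g \<Rightarrow> 'r) \<Rightarrow> bool" where
  "is_decomp x h \<longleftrightarrow> (\<forall>\<sigma> \<in> mor \<Gamma>. h \<sigma> \<in> R \<sigma>) \<and> (\<forall>\<sigma>. \<sigma> \<notin> mor \<Gamma> \<longrightarrow> h \<sigma> = 0) \<and>
     finite {\<sigma>. h \<sigma> \<noteq> 0} \<and> x = (\<Sum>\<sigma> | h \<sigma> \<noteq> 0. h \<sigma>)"

definition hpart :: "'g \<Rightarrow> 'r \<Rightarrow> 'r" where
  "hpart \<sigma> x = (THE h. is_decomp x h) \<sigma>"

definition supp :: "'r \<Rightarrow> 'g set" where
  "supp x = {\<sigma>. hpart \<sigma> x \<noteq> 0}"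

lemma ex1_decomp: "\<exists>!h. is_decomp x h"
  using graded unfolding graded_def is_decomp_def by blast

lemma is_decomp_hpart: "is_decomp x (\<lambda>\<sigma>. hpart \<sigma> x)"
  unfolding hpart_def using theI'[OF ex1_decomp] by simp

lemma hpart_in: "\<sigma> \<in> mor \<Gamma> \<Longrightarrow> hpart \<sigma> x \<in> R \<sigma>"
  and finite_supp [simp]: "finite (supp x)"
  and sum_hpart_supp: "(\<Sum>\<sigma>\<in>supp x. hpart \<sigma> x) = x"
  and supp_mor: "supp x \<subseteq> mor \<Gamma>"
  using is_decomp_hpart[of x] unfolding is_decomp_def supp_def by auto

lemma sum_hpart_superset:
  assumes "finite A" "supp x \<subseteq> A" shows "(\<Sum>\<sigma>\<in>A. hpart \<sigma> x) = x"
proof -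
  have "(\<Sum>\<sigma>\<in>supp x. hpart \<sigma> x) = (\<Sum>\<sigma>\<in>A. hpart \<sigma> x)"
    using assms by (intro sum.mono_neutral_left) (auto simp: supp_def)
  then show ?thesis by (simp add: sum_hpart_supp)
qed

text \<open>Uniqueness of the decomposition: any finite family of the right degrees with sum
  \<open>x\<close> is the family of components. \<open>A\<close> may contain degrees where
  \<open>h\<close> vanishes.\<close>

lemma hpart_eqI:
  assumes R: "\<And>\<sigma>. \<sigma> \<in> mor \<Gamma> \<Longrightarrow> h \<sigma> \<in> R \<sigma>" and zero: "\<And>\<sigma>. \<sigma> \<notin> A \<Longrightarrow> h \<sigma> = 0"
    and A: "finite A" "A \<subseteq> mor \<Gamma>" and x: "(\<Sum>\<sigma>\<in>A. h \<sigma>) = x"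
  shows "hpart \<sigma> x = h \<sigma>"
proof -
  have sub: "{\<sigma>. h \<sigma> \<noteq> 0} \<subseteq> A" using zero by blast
  then have fin: "finite {\<sigma>. h \<sigma> \<noteq> 0}"
    using A(1) by (rule finite_subset)
  have "(\<Sum>\<sigma> | h \<sigma> \<noteq> 0. h \<sigma>) = (\<Sum>\<sigma>\<in>A. h \<sigma>)"
    using A(1) sub by (rule sum.mono_neutral_left) blast
  then have "x = (\<Sum>\<sigma> | h \<sigma> \<noteq> 0. h \<sigma>)" using x by simp
  then have "is_decomp x h"
    unfolding is_decomp_def using R zero A(2) fin by blast
  then have "(THE h. is_decomp x h) = h"
    using ex1_decomp by (intro the1_equality)
  then show ?thesis by (simp add: hpart_def)
qed

lemma hpart_add: "hpart \<sigma> (x + y) = hpart \<sigma> x + hpart \<sigma> y"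
proof (rule hpart_eqI[of _ "supp x \<union> supp y"])
  show "(\<Sum>\<sigma>\<in>supp x \<union> supp y. hpart \<sigma> x + hpart \<sigma> y) = x + y"
    by (simp add: sum.distrib sum_hpart_superset)
  show "supp x \<union> supp y \<subseteq> mor \<Gamma>" using supp_mor by blast
  show "hpart \<sigma> x + hpart \<sigma> y = 0" if "\<sigma> \<notin> supp x \<union> supp y" for \<sigma>
    using that by (simp add: supp_def)
qed (simp_all add: R_add hpart_in)

lemma hpart_homogeneous:
  assumes "\<sigma> \<in> mor \<Gamma>" "x \<in> R \<sigma>"
  shows "hpart \<tau> x = (if \<tau> = \<sigma> then x else 0)"
  by (rule hpart_eqI[of _ "{\<sigma>}"]) (use assms in auto)

lemma supp_add: "supp (x + y) \<subseteq> supp x \<union> supp y"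
  by (auto simp: supp_def hpart_add)

lemma hpart_0 [simp]: "hpart \<sigma> 0 = 0"
  using hpart_add[of \<sigma> 0 0] by simp

lemma graded_induct [case_names homogeneous zero add]:
  assumes "\<And>\<sigma> x. \<sigma> \<in> mor \<Gamma> \<Longrightarrow> x \<in> R \<sigma> \<Longrightarrow> P x" "P 0" "\<And>x y. P x \<Longrightarrow> P y \<Longrightarrow> P (x + y)"
  shows "P x"
proof -
  have "P (\<Sum>\<sigma>\<in>A. hpart \<sigma> x)" if "finite A" "A \<subseteq> mor \<Gamma>" for A
    using that by (induction A rule: finite_induct) (auto intro: assms hpart_in)
  from this[OF finite_supp supp_mor, of x] show ?thesis by (simp add: sum_hpart_supp)
qed

section \<open>Projections onto sets of degrees\<close>

definition proj :: "'g set \<Rightarrow> 'r \<Rightarrow> 'r" where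
  "proj X x = (\<Sum>\<sigma> \<in> X \<inter> supp x. hpart \<sigma> x)"

lemma proj_superset: "finite A \<Longrightarrow> supp x \<subseteq> A \<Longrightarrow> proj X x = (\<Sum>\<sigma> \<in> X \<inter> A. hpart \<sigma> x)"
  unfolding proj_def by (rule sum.mono_neutral_left) (auto simp: supp_def)

lemma proj_add: "proj X (x + y) = proj X x + proj X y"
proof -
  have "supp (x + y) \<subseteq> supp x \<union> supp y" by (auto simp: supp_def hpart_add)
  then show ?thesis
    by (simp add: proj_superset[of "supp x \<union> supp y"] sum.distrib hpart_add)
qed

lemma proj_0 [simp]: "proj X 0 = 0"
  by (simp add: proj_def)

lemma proj_sum: "proj X (sum f I) = (\<Sum>i\<in>I. proj X (f i))"
  by (induction I rule: infinite_finite_induct) (auto simp: proj_add)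

lemma proj_homogeneous:
  assumes "\<sigma> \<in> mor \<Gamma>" "x \<in> R \<sigma>"
  shows "proj X x = (if \<sigma> \<in> X then x else 0)"
proof -
  have "supp x \<subseteq> {\<sigma>}" by (auto simp: supp_def hpart_homogeneous[OF assms] split: if_splits)
  then have "proj X x = (\<Sum>\<tau> \<in> X \<inter> {\<sigma>}. hpart \<tau> x)" by (rule proj_superset[rotated]) simp
  then show ?thesis by (simp add: hpart_homogeneous[OF assms])
qed

lemma proj_cong_supp: "X \<inter> supp x = Y \<inter> supp x \<Longrightarrow> proj X x = proj Y x"
  by (simp add: proj_def)

lemma proj_singleton_in: "\<sigma> \<in> mor \<Gamma> \<Longrightarrow> proj {\<sigma>} x \<in> R \<sigma>"
  unfolding proj_def by (rule R_sum) (auto intro: hpart_in)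

lemma finite_proj_singleton: "finite {\<sigma>. proj {\<sigma>} x \<noteq> 0}"
proof (rule finite_subset[OF _ finite_supp])
  show "{\<sigma>. proj {\<sigma>} x \<noteq> 0} \<subseteq> supp x"
    by (auto simp: proj_def intro: ccontr)
qed

lemma proj_UN:
  assumes "finite I" "\<And>i j. i \<in> I \<Longrightarrow> j \<in> I \<Longrightarrow> i \<noteq> j \<Longrightarrow> X i \<inter> X j = {}"
  shows "proj (\<Union>i\<in>I. X i) x = (\<Sum>i\<in>I. proj (X i) x)"
proof -
  have "(\<Union>i\<in>I. X i) \<inter> supp x = (\<Union>i\<in>I. X i \<inter> supp x)" by blast
  then show ?thesis
    unfolding proj_def using assms by (simp only:) (intro sum.UNION_disjoint; blast intro: finite_Int finite_supp)
qed

text \<open>Left multiplication by \<open>a\<close> shifts degree \<open>\<sigma>\<close> to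
  \<open>\<rho>\<sigma>\<close>, so it intertwines the projections when \<open>X\<close> and
  \<open>Y\<close> correspond under this shift. Degrees that do not compose with
  \<open>\<rho>\<close> impose no condition, because those products vanish.\<close>

lemma proj_mult_left:
  assumes "\<rho> \<in> mor \<Gamma>" "a \<in> R \<rho>"
    and "\<And>\<sigma>. \<sigma> \<in> mor \<Gamma> \<Longrightarrow> dm \<Gamma> \<rho> = rg \<Gamma> \<sigma> \<Longrightarrow> \<sigma> \<in> X \<longleftrightarrow> comp \<Gamma> \<rho> \<sigma> \<in> Y"
  shows "proj Y (a * x) = a * proj X x"
proof (induction x rule: graded_induct)
  case (homogeneous \<sigma> x)
  show ?case
  proof (cases "dm \<Gamma> \<rho> = rg \<Gamma> \<sigma>")
    case True
    then show ?thesis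
      using homogeneous assms R_mult(1)[of \<rho> \<sigma> a x]
      by (simp add: proj_homogeneous[of \<sigma>] proj_homogeneous[of "comp \<Gamma> \<rho> \<sigma>"])
  next
    case False
    then show ?thesis
      using homogeneous assms R_mult(2)[of \<rho> \<sigma> a x] by (simp add: proj_homogeneous[of \<sigma>])
  qed
qed (simp_all add: proj_add distrib_left)

lemma proj_mult_right:
  assumes "\<rho> \<in> mor \<Gamma>" "a \<in> R \<rho>"
    and "\<And>\<sigma>. \<sigma> \<in> mor \<Gamma> \<Longrightarrow> dm \<Gamma> \<sigma> = rg \<Gamma> \<rho> \<Longrightarrow> \<sigma> \<in> X \<longleftrightarrow> comp \<Gamma> \<sigma> \<rho> \<in> Y"
  shows "proj Y (x * a) = proj X x * a"
proof (induction x rule: graded_induct)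
  case (homogeneous \<sigma> x)
  show ?case
  proof (cases "dm \<Gamma> \<sigma> = rg \<Gamma> \<rho>")
    case True
    then show ?thesis
      using homogeneous assms R_mult(1)[of \<sigma> \<rho> x a]
      by (simp add: proj_homogeneous[of \<sigma>] proj_homogeneous[of "comp \<Gamma> \<sigma> \<rho>"])
  next
    case False
    then show ?thesis
      using homogeneous assms R_mult(2)[of \<sigma> \<rho> x a] by (simp add: proj_homogeneous[of \<sigma>])
  qed
qed (simp_all add: proj_add distrib_right)

text \<open>\<open>1\<^sub>e\<close> fixes the components with range \<open>e\<close> and kills the
  others.\<close>

lemma ident_mult_eq_proj:
  assumes "e \<in> obj \<Gamma> (mor \<Gamma>)"
  shows "ident (R e) * x = proj {\<sigma> \<in> mor \<Gamma>. rg \<Gamma> \<sigma> = e} x"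
proof (induction x rule: graded_induct)
  case (homogeneous \<sigma> x)
  then show ?case
    by (auto simp: proj_homogeneous[of \<sigma>] ident_mult ident_mult_zero assms)
qed (simp_all add: proj_add distrib_left)

section \<open>Subgroups spanned by sets of degrees\<close>

lemma homogeneous_in_part: "\<sigma> \<in> X \<Longrightarrow> x \<in> R \<sigma> \<Longrightarrow> x \<in> part R X"
  unfolding part_def by (intro CollectI exI[of _ "{\<sigma>}"] exI[of _ "\<lambda>_. x"]) auto

lemma part_induct [consumes 2, case_names homogeneous zero add]:
  assumes "x \<in> part R X" "X \<subseteq> mor \<Gamma>"
    and "\<And>\<sigma> x. \<sigma> \<in> X \<Longrightarrow> x \<in> R \<sigma> \<Longrightarrow> P x" "P 0" "\<And>x y. P x \<Longrightarrow> P y \<Longrightarrow> P (x + y)"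
  shows "P x"
proof -
  obtain F h where "finite F" "F \<subseteq> X" "\<forall>\<sigma>\<in>F. h \<sigma> \<in> R \<sigma>" "x = (\<Sum>\<sigma>\<in>F. h \<sigma>)"
    using assms(1) unfolding part_def by blast
  moreover have "P (\<Sum>\<sigma>\<in>F. h \<sigma>)" if "finite F" "F \<subseteq> X" "\<forall>\<sigma>\<in>F. h \<sigma> \<in> R \<sigma>" for F h
    using that by (induction F rule: finite_induct) (auto intro: assms(3-))
  ultimately show ?thesis by simp
qed

lemma part_iff:
  assumes "X \<subseteq> mor \<Gamma>"
  shows "x \<in> part R X \<longleftrightarrow> supp x \<subseteq> X"
proof
  assume "x \<in> part R X"
  then show "supp x \<subseteq> X" using assms
  proof (induction rule: part_induct)
    case (homogeneous \<sigma> x)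
    then show ?case
      using assms by (auto simp: supp_def hpart_homogeneous[of \<sigma>] split: if_splits)
  qed (auto simp: supp_def[of 0] dest: subsetD[OF supp_add])
next
  assume "supp x \<subseteq> X"
  then have "finite (supp x) \<and> supp x \<subseteq> X \<and> (\<forall>\<sigma>\<in>supp x. hpart \<sigma> x \<in> R \<sigma>)"
    using supp_mor[of x] hpart_in[of _ x] by (auto simp del: finite_supp intro: finite_supp)
  then have "(\<Sum>\<sigma>\<in>supp x. hpart \<sigma> x) \<in> part R X"
    unfolding part_def by blast
  then show "x \<in> part R X" by (simp add: sum_hpart_supp)
qed

lemma part_0: "0 \<in> part R X"
  unfolding part_def by (intro CollectI exI[of _ "{}"]) auto

lemma part_add: "X \<subseteq> mor \<Gamma> \<Longrightarrow> x \<in> part R X \<Longrightarrow> y \<in> part R X \<Longrightarrow> x + y \<in> part R X"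
  using supp_add[of x y] by (auto simp: part_iff)

lemma part_sum:
  "X \<subseteq> mor \<Gamma> \<Longrightarrow> (\<And>i. i \<in> I \<Longrightarrow> f i \<in> part R X) \<Longrightarrow> sum f I \<in> part R X"
  by (induction I rule: infinite_finite_induct) (auto intro: part_0 part_add)

lemma hpart_minus: "hpart \<sigma> (- x) = - hpart \<sigma> x"
  using hpart_add[of \<sigma> x "- x"] by (simp add: minus_unique)

lemma is_subring_part:
  assumes "X \<subseteq> mor \<Gamma>"
    and "\<And>\<sigma> \<tau>. \<sigma> \<in> X \<Longrightarrow> \<tau> \<in> X \<Longrightarrow> dm \<Gamma> \<sigma> = rg \<Gamma> \<tau> \<Longrightarrow> comp \<Gamma> \<sigma> \<tau> \<in> X"
  shows "is_subring (part R X)"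
proof -
  have "x - y \<in> part R X" if "x \<in> part R X" "y \<in> part R X" for x y
    using that part_add[OF assms(1), of x "- y"]
    by (simp add: part_iff[OF assms(1)] supp_def hpart_minus)
  moreover have "x * y \<in> part R X" if x: "x \<in> part R X" and y: "y \<in> part R X" for x y
    using x assms(1)
  proof (induction rule: part_induct)
    case (homogeneous \<sigma> a)
    show ?case using y assms(1)
    proof (induction rule: part_induct)
      case (homogeneous \<tau> b)
      have "\<sigma> \<in> mor \<Gamma>" "\<tau> \<in> mor \<Gamma>"
        using \<open>\<sigma> \<in> X\<close> \<open>\<tau> \<in> X\<close> assms(1) by auto
      note mult = R_mult[OF this \<open>a \<in> R \<sigma>\<close> \<open>b \<in> R \<tau>\<close>]
      show ?case
      proof (cases "dm \<Gamma> \<sigma> = rg \<Gamma> \<tau>")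
        case True
        show ?thesis
          by (rule homogeneous_in_part[OF assms(2)[OF \<open>\<sigma> \<in> X\<close> \<open>\<tau> \<in> X\<close> True] mult(1)[OF True]])
      next
        case False
        then show ?thesis using mult(2) part_0 by simp
      qed
    qed (simp_all add: distrib_left part_0 part_add assms(1))
  qed (simp_all add: distrib_right part_0 part_add assms(1))
  ultimately show ?thesis
    unfolding is_subring_def additive_subgroup_def by (auto intro: part_0)
qed

end

section \<open>Cosets of a wide subgroupoid\<close>

locale relative_trace_setting = object_unital_graded \<Gamma> R
  for \<Gamma> :: "'g cat" and R :: "'g \<Rightarrow> 'r::ring set" +
  fixes \<Delta> T :: "'g set" and n :: "'g \<Rightarrow> nat" and u v :: "'g \<Rightarrow> nat \<Rightarrow> 'r"
  assumes wide: "wide_subgroupoid \<Gamma> \<Delta>"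
    and decomposition: "unit_decomposition \<Gamma> R n u v"
    and transversal: "right_transversal \<Gamma> (Iso \<Gamma> \<Delta>) T"
begin

lemma \<Delta>_mor: "\<sigma> \<in> \<Delta> \<Longrightarrow> \<sigma> \<in> mor \<Gamma>"
  and \<Delta>_subset: "\<Delta> \<subseteq> mor \<Gamma>"
  and groupoid_\<Delta>: "groupoid (\<Gamma>\<lparr>mor := \<Delta>\<rparr>)"
  using wide unfolding wide_subgroupoid_def subgroupoid_def by blast+

lemma comp_\<Delta> [simp]: "\<sigma> \<in> \<Delta> \<Longrightarrow> \<tau> \<in> \<Delta> \<Longrightarrow> dm \<Gamma> \<sigma> = rg \<Gamma> \<tau> \<Longrightarrow> comp \<Gamma> \<sigma> \<tau> \<in> \<Delta>"
  using category.comp_mor[OF groupoid.axioms(1)[OF groupoid_\<Delta>], of \<sigma> \<tau>] by simp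

lemma obj_in_\<Delta>: "e \<in> obj \<Gamma> (mor \<Gamma>) \<Longrightarrow> e \<in> \<Delta>"
proof -
  assume "e \<in> obj \<Gamma> (mor \<Gamma>)"
  then obtain \<delta> where "\<delta> \<in> \<Delta>" "e = dm \<Gamma> \<delta>"
    using wide unfolding wide_subgroupoid_def obj_def by blast
  then show ?thesis
    using category.dm_mor[OF groupoid.axioms(1)[OF groupoid_\<Delta>], of \<delta>] by simp
qed

lemma ginv_\<Delta> [simp]: "\<sigma> \<in> \<Delta> \<Longrightarrow> ginv \<Gamma> \<sigma> \<in> \<Delta>"
proof -
  assume "\<sigma> \<in> \<Delta>"
  then obtain \<tau> where "is_inverse (\<Gamma>\<lparr>mor := \<Delta>\<rparr>) \<sigma> \<tau>"
    using groupoid.ex_inverse[OF groupoid_\<Delta>, of \<sigma>] by auto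
  then have "\<tau> \<in> \<Delta>" "is_inverse \<Gamma> \<sigma> \<tau>"
    using \<Delta>_mor unfolding is_inverse_def by auto
  then show ?thesis using ginv_eqI[OF \<Delta>_mor[OF \<open>\<sigma> \<in> \<Delta>\<close>]] by simp
qed

lemma mem_Iso: "\<sigma> \<in> Iso \<Gamma> \<Delta> \<longleftrightarrow> \<sigma> \<in> \<Delta> \<and> dm \<Gamma> \<sigma> = rg \<Gamma> \<sigma>"
  unfolding Iso_def hom_set_def obj_def by auto

lemma Iso_subset: "Iso \<Gamma> \<Delta> \<subseteq> mor \<Gamma>"
  using \<Delta>_mor by (auto simp: mem_Iso)

text \<open>The coset \<open>\<tau>\<Delta>\<close>, described by
  \<open>\<tau>\<inverse>\<sigma> \<in> \<Delta>\<close>. Its members share their range but not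
  necessarily their domain, as \<open>\<Delta>\<close> may join different objects.\<close>

definition dcoset :: "'g \<Rightarrow> 'g set" where
  "dcoset \<tau> = {\<sigma> \<in> mor \<Gamma>. rg \<Gamma> \<sigma> = rg \<Gamma> \<tau> \<and> comp \<Gamma> (ginv \<Gamma> \<tau>) \<sigma> \<in> \<Delta>}"

lemma dcoset_refl: "\<tau> \<in> mor \<Gamma> \<Longrightarrow> \<tau> \<in> dcoset \<tau>"
  by (simp add: dcoset_def obj_in_\<Delta> dm_obj)

text \<open>A common element \<open>\<rho>\<close> gives \<open>\<sigma>\<inverse>\<tau> =
  (\<sigma>\<inverse>\<rho>)(\<tau>\<inverse>\<rho>)\<inverse>\<close>, a composite of two elements
  of \<open>\<Delta>\<close>.\<close>

lemma dcoset_overlap: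
  assumes "\<sigma> \<in> mor \<Gamma>" "\<tau> \<in> mor \<Gamma>" "\<rho> \<in> dcoset \<sigma>" "\<rho> \<in> dcoset \<tau>"
  shows "\<tau> \<in> dcoset \<sigma>"
proof -
  have "comp \<Gamma> (comp \<Gamma> (ginv \<Gamma> \<sigma>) \<rho>) (ginv \<Gamma> (comp \<Gamma> (ginv \<Gamma> \<tau>) \<rho>)) \<in> \<Delta>"
    using assms by (intro comp_\<Delta>[OF _ ginv_\<Delta>]) (auto simp: dcoset_def)
  then show ?thesis
    using assms by (simp add: dcoset_def)
qed

lemma dcoset_eq:
  assumes "\<sigma> \<in> mor \<Gamma>" "\<tau> \<in> dcoset \<sigma>" shows "dcoset \<tau> = dcoset \<sigma>"
proof -
  have \<tau>: "\<tau> \<in> mor \<Gamma>" using assms by (simp add: dcoset_def)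
  have "\<sigma> \<in> dcoset \<tau>"
    by (rule dcoset_overlap[of _ _ \<tau>]) (use assms \<tau> dcoset_refl in auto)
  have "\<rho> \<in> dcoset \<alpha>" if "\<alpha> \<in> mor \<Gamma>" "\<beta> \<in> mor \<Gamma>" "\<beta> \<in> dcoset \<alpha>" "\<rho> \<in> dcoset \<beta>" for \<alpha> \<beta> \<rho>
  proof -
    have \<rho>: "\<rho> \<in> mor \<Gamma>" using that by (simp add: dcoset_def)
    have "\<beta> \<in> dcoset \<rho>"
      by (rule dcoset_overlap[OF \<rho> that(2) dcoset_refl[OF \<rho>] that(4)])
    then show ?thesis
      by (rule dcoset_overlap[OF that(1) \<rho> that(3)])
  qed
  with assms(1) \<tau> \<open>\<sigma> \<in> dcoset \<tau>\<close> assms(2) show ?thesis by blast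
qed

text \<open>The factor \<open>\<rho>\<close> cancels in
  \<open>(\<rho>\<tau>)\<inverse>(\<rho>\<sigma>)\<close>.\<close>

lemma dcoset_comp_left:
  assumes "\<rho> \<in> mor \<Gamma>" "\<tau> \<in> mor \<Gamma>" "\<sigma> \<in> mor \<Gamma>" "dm \<Gamma> \<rho> = rg \<Gamma> \<tau>" "dm \<Gamma> \<rho> = rg \<Gamma> \<sigma>"
  shows "\<sigma> \<in> dcoset \<tau> \<longleftrightarrow> comp \<Gamma> \<rho> \<sigma> \<in> dcoset (comp \<Gamma> \<rho> \<tau>)"
  using assms by (simp add: dcoset_def)

lemma dcoset_comp_right:
  assumes "\<delta> \<in> \<Delta>" "\<tau> \<in> mor \<Gamma>" "\<sigma> \<in> mor \<Gamma>" "dm \<Gamma> \<sigma> = rg \<Gamma> \<delta>"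
  shows "\<sigma> \<in> dcoset \<tau> \<longleftrightarrow> comp \<Gamma> \<sigma> \<delta> \<in> dcoset \<tau>"
proof -
  have "comp \<Gamma> (ginv \<Gamma> \<tau>) \<sigma> \<in> \<Delta> \<longleftrightarrow> comp \<Gamma> (ginv \<Gamma> \<tau>) (comp \<Gamma> \<sigma> \<delta>) \<in> \<Delta>"
    if "rg \<Gamma> \<sigma> = rg \<Gamma> \<tau>"
    using assms that \<Delta>_mor[OF assms(1)] comp_\<Delta>[of "comp \<Gamma> (ginv \<Gamma> \<tau>) \<sigma>" \<delta>]
      comp_\<Delta>[of "comp \<Gamma> (ginv \<Gamma> \<tau>) (comp \<Gamma> \<sigma> \<delta>)" "ginv \<Gamma> \<delta>"] by auto
  then show ?thesis
    using assms \<Delta>_mor[OF assms(1)] by (auto simp: dcoset_def)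
qed

text \<open>The element \<open>\<tau>\<inverse>\<sigma>\<close> of \<open>\<Delta>\<close> runs from
  the domain of \<open>\<sigma>\<close> to that of \<open>\<tau>\<close>, so it lies in
  \<open>Iso \<Gamma> \<Delta>\<close> exactly when the domains agree. This is the difference
  between cosets of \<open>\<Lambda>\<close> and cosets of \<open>\<Delta>\<close>.\<close>

lemma right_translate_eq_iff:
  assumes "\<sigma> \<in> mor \<Gamma>" "\<tau> \<in> mor \<Gamma>"
  shows "right_translate \<Gamma> \<sigma> (Iso \<Gamma> \<Delta>) = right_translate \<Gamma> \<tau> (Iso \<Gamma> \<Delta>) \<longleftrightarrow>
    dm \<Gamma> \<sigma> = dm \<Gamma> \<tau> \<and> \<sigma> \<in> dcoset \<tau>"
proof -
  have mem: "\<rho> \<in> right_translate \<Gamma> \<alpha> (Iso \<Gamma> \<Delta>) \<longleftrightarrow> dm \<Gamma> \<rho> = dm \<Gamma> \<alpha> \<and> \<rho> \<in> dcoset \<alpha>"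
    if \<alpha>: "\<alpha> \<in> mor \<Gamma>" for \<rho> \<alpha>
  proof
    assume "\<rho> \<in> right_translate \<Gamma> \<alpha> (Iso \<Gamma> \<Delta>)"
    then obtain \<kappa> where "\<rho> = comp \<Gamma> \<alpha> \<kappa>" "\<kappa> \<in> \<Delta>" "dm \<Gamma> \<kappa> = rg \<Gamma> \<kappa>" "dm \<Gamma> \<alpha> = rg \<Gamma> \<kappa>"
      unfolding right_translate_def mem_Iso by blast
    then show "dm \<Gamma> \<rho> = dm \<Gamma> \<alpha> \<and> \<rho> \<in> dcoset \<alpha>"
      using \<alpha> \<Delta>_mor[of \<kappa>] by (simp add: dcoset_def)
  next
    assume "dm \<Gamma> \<rho> = dm \<Gamma> \<alpha> \<and> \<rho> \<in> dcoset \<alpha>"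
    then show "\<rho> \<in> right_translate \<Gamma> \<alpha> (Iso \<Gamma> \<Delta>)"
      using \<alpha> unfolding right_translate_def mem_Iso dcoset_def
      by (intro CollectI exI[of _ "comp \<Gamma> (ginv \<Gamma> \<alpha>) \<rho>"]) auto
  qed
  show ?thesis
  proof
    assume "right_translate \<Gamma> \<sigma> (Iso \<Gamma> \<Delta>) = right_translate \<Gamma> \<tau> (Iso \<Gamma> \<Delta>)"
    then show "dm \<Gamma> \<sigma> = dm \<Gamma> \<tau> \<and> \<sigma> \<in> dcoset \<tau>"
      using mem[OF assms(1), of \<sigma>] mem[OF assms(2), of \<sigma>] dcoset_refl[OF assms(1)] by simp
  next
    assume *: "dm \<Gamma> \<sigma> = dm \<Gamma> \<tau> \<and> \<sigma> \<in> dcoset \<tau>"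
    then have "dcoset \<sigma> = dcoset \<tau>" using dcoset_eq assms by blast
    with * show "right_translate \<Gamma> \<sigma> (Iso \<Gamma> \<Delta>) = right_translate \<Gamma> \<tau> (Iso \<Gamma> \<Delta>)"
      using mem[OF assms(1)] mem[OF assms(2)] by (simp add: Set.set_eq_iff)
  qed
qed

lemma T_mor: "\<tau> \<in> T \<Longrightarrow> \<tau> \<in> mor \<Gamma>"
  using transversal unfolding right_transversal_def by blast

lemma ex_T:
  assumes "\<sigma> \<in> mor \<Gamma>"
  obtains \<tau> where "\<tau> \<in> T" "\<tau> \<in> mor \<Gamma>" "dm \<Gamma> \<tau> = dm \<Gamma> \<sigma>" "rg \<Gamma> \<tau> = rg \<Gamma> \<sigma>" "\<sigma> \<in> dcoset \<tau>"
proof -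
  obtain \<tau> where \<tau>: "\<tau> \<in> T"
    "right_translate \<Gamma> \<sigma> (Iso \<Gamma> \<Delta>) = right_translate \<Gamma> \<tau> (Iso \<Gamma> \<Delta>)"
    using transversal assms unfolding right_transversal_def by blast
  then have "dm \<Gamma> \<sigma> = dm \<Gamma> \<tau> \<and> \<sigma> \<in> dcoset \<tau>"
    using right_translate_eq_iff[OF assms T_mor] by blast
  with \<tau> show ?thesis by (intro that[of \<tau>]) (auto simp: T_mor dcoset_def)
qed

lemma T_unique:
  assumes "\<sigma> \<in> T" "\<tau> \<in> T" "dm \<Gamma> \<sigma> = dm \<Gamma> \<tau>" "\<sigma> \<in> dcoset \<tau>"
  shows "\<sigma> = \<tau>"
proof -
  have "right_translate \<Gamma> \<sigma> (Iso \<Gamma> \<Delta>) = right_translate \<Gamma> \<tau> (Iso \<Gamma> \<Delta>)"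
    using right_translate_eq_iff[of \<sigma> \<tau>] assms T_mor by blast
  then show ?thesis
    using transversal assms T_mor[OF assms(1)] unfolding right_transversal_def by blast
qed

lemma u_in: "\<sigma> \<in> mor \<Gamma> \<Longrightarrow> i \<in> {1..n \<sigma>} \<Longrightarrow> u \<sigma> i \<in> R \<sigma>"
  and v_in: "\<sigma> \<in> mor \<Gamma> \<Longrightarrow> i \<in> {1..n \<sigma>} \<Longrightarrow> v (ginv \<Gamma> \<sigma>) i \<in> R (ginv \<Gamma> \<sigma>)"
  and sum_u_v: "\<sigma> \<in> mor \<Gamma> \<Longrightarrow> (\<Sum>i=1..n \<sigma>. u \<sigma> i * v (ginv \<Gamma> \<sigma>) i) = ident (R (rg \<Gamma> \<sigma>))"
  using decomposition unfolding unit_decomposition_def by blast+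

abbreviation "part\<^sub>0 \<equiv> part R (obj \<Gamma> (mor \<Gamma>))"
abbreviation "invariants \<equiv> centralizer part\<^sub>0 (part R (Iso \<Gamma> \<Delta>))"

text \<open>Products of \<open>a\<close> with components of \<open>r\<close> at other objects than
  the domain of \<open>\<sigma>\<close> are not composable and vanish.\<close>

lemma mult_part0:
  assumes "r \<in> part\<^sub>0" "\<sigma> \<in> mor \<Gamma>" "a \<in> R \<sigma>"
  shows "a * r = a * proj {dm \<Gamma> \<sigma>} r"
proof -
  have sub: "obj \<Gamma> (mor \<Gamma>) \<subseteq> mor \<Gamma>" by (auto simp: obj_def)
  show ?thesis using assms(1) sub
  proof (induction rule: part_induct)
    case (homogeneous f x)
    then have "f \<in> mor \<Gamma>" "rg \<Gamma> f = f" by (auto simp: obj_simps)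
    then show ?case
      using homogeneous R_mult(2)[OF assms(2) \<open>f \<in> mor \<Gamma>\<close> assms(3)]
      by (auto simp: proj_homogeneous[of f])
  qed (simp_all add: distrib_left proj_add)
qed

text \<open>The members of \<open>T\<close> from \<open>f\<close> to \<open>f\<close> represent each
  left coset of \<open>\<Delta>(f)\<close> in \<open>\<Gamma>(f)\<close> exactly once.\<close>

lemma fin_obj_iff:
  assumes "f \<in> obj \<Gamma> (mor \<Gamma>)"
  shows "f \<in> fin_obj \<Gamma> \<Delta> \<longleftrightarrow> finite (hom_set \<Gamma> T f f)"
proof -
  note f = obj_simps[OF assms]
  define C where "C \<tau> = \<tau> <#\<^bsub>vertex_group \<Gamma> f\<^esub> hom_set \<Gamma> \<Delta> f f" for \<tau>
  have mem_C: "\<rho> \<in> C \<tau> \<longleftrightarrow> \<rho> \<in> dcoset \<tau> \<and> dm \<Gamma> \<rho> = f"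
    if "\<tau> \<in> mor \<Gamma>" "dm \<Gamma> \<tau> = f" "rg \<Gamma> \<tau> = f" for \<tau> \<rho>
  proof -
    have "\<rho> \<in> C \<tau> \<longleftrightarrow> (\<exists>\<delta>\<in>\<Delta>. dm \<Gamma> \<delta> = f \<and> rg \<Gamma> \<delta> = f \<and> \<rho> = comp \<Gamma> \<tau> \<delta>)"
      by (auto simp: C_def l_coset_def vertex_group_def hom_set_def)
    also have "\<dots> \<longleftrightarrow> \<rho> \<in> dcoset \<tau> \<and> dm \<Gamma> \<rho> = f"
    proof
      assume "\<exists>\<delta>\<in>\<Delta>. dm \<Gamma> \<delta> = f \<and> rg \<Gamma> \<delta> = f \<and> \<rho> = comp \<Gamma> \<tau> \<delta>"
      then show "\<rho> \<in> dcoset \<tau> \<and> dm \<Gamma> \<rho> = f"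
        using that \<Delta>_mor by (auto simp: dcoset_def)
    next
      assume "\<rho> \<in> dcoset \<tau> \<and> dm \<Gamma> \<rho> = f"
      then show "\<exists>\<delta>\<in>\<Delta>. dm \<Gamma> \<delta> = f \<and> rg \<Gamma> \<delta> = f \<and> \<rho> = comp \<Gamma> \<tau> \<delta>"
        using that by (intro bexI[of _ "comp \<Gamma> (ginv \<Gamma> \<tau>) \<rho>"]) (auto simp: dcoset_def)
    qed
    finally show ?thesis .
  qed
  have "lcosets\<^bsub>vertex_group \<Gamma> f\<^esub> (hom_set \<Gamma> \<Delta> f f) = C ` hom_set \<Gamma> (mor \<Gamma>) f f"
    by (auto simp: LCOSETS_def C_def vertex_group_def)
  also have "\<dots> = C ` hom_set \<Gamma> T f f"
  proof (rule subset_antisym)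
    show "C ` hom_set \<Gamma> (mor \<Gamma>) f f \<subseteq> C ` hom_set \<Gamma> T f f"
    proof
      fix X assume "X \<in> C ` hom_set \<Gamma> (mor \<Gamma>) f f"
      then obtain \<sigma> where \<sigma>: "\<sigma> \<in> mor \<Gamma>" "dm \<Gamma> \<sigma> = f" "rg \<Gamma> \<sigma> = f" "X = C \<sigma>"
        by (auto simp: hom_set_def)
      from ex_T[OF \<sigma>(1)] obtain \<tau> where \<tau>: "\<tau> \<in> T" "\<tau> \<in> mor \<Gamma>" "dm \<Gamma> \<tau> = dm \<Gamma> \<sigma>"
        "rg \<Gamma> \<tau> = rg \<Gamma> \<sigma>" "\<sigma> \<in> dcoset \<tau>" .
      then have "dcoset \<sigma> = dcoset \<tau>" by (intro dcoset_eq)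
      then have "\<rho> \<in> C \<sigma> \<longleftrightarrow> \<rho> \<in> C \<tau>" for \<rho>
        using mem_C \<sigma> \<tau> by simp
      then have "C \<sigma> = C \<tau>" by blast
      then show "X \<in> C ` hom_set \<Gamma> T f f"
        using \<sigma> \<tau> by (auto simp: hom_set_def)
    qed
    show "C ` hom_set \<Gamma> T f f \<subseteq> C ` hom_set \<Gamma> (mor \<Gamma>) f f"
      by (intro image_mono) (auto simp: hom_set_def T_mor)
  qed
  finally have "f \<in> fin_obj \<Gamma> \<Delta> \<longleftrightarrow> finite (C ` hom_set \<Gamma> T f f)"
    by (simp add: fin_obj_def assms)
  moreover have "inj_on C (hom_set \<Gamma> T f f)"
  proof (rule inj_onI)
    fix \<sigma> \<tau> assume *: "\<sigma> \<in> hom_set \<Gamma> T f f" "\<tau> \<in> hom_set \<Gamma> T f f" "C \<sigma> = C \<tau>"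
    then have "\<sigma> \<in> dcoset \<tau>"
      using mem_C[of \<sigma> \<sigma>] mem_C[of \<tau> \<sigma>] by (simp add: hom_set_def T_mor dcoset_refl)
    then show "\<sigma> = \<tau>" using T_unique * by (simp add: hom_set_def)
  qed
  ultimately show ?thesis by (simp add: finite_image_iff)
qed

text \<open>For a fixed \<open>\<sigma>\<close> from \<open>f\<close> to \<open>e\<close>, sending
  \<open>\<tau>\<close> to the representative of \<open>\<sigma>\<inverse>\<tau>\<close> embeds the
  set in question into the finite set of representatives from \<open>f\<close> to
  \<open>f\<close>.\<close>

lemma finite_hom_T:
  assumes "f \<in> fin_obj \<Gamma> \<Delta>" shows "finite (hom_set \<Gamma> T f e)"
proof (cases "hom_set \<Gamma> T f e = {}")
  case False
  then obtain \<sigma> where \<sigma>: "\<sigma> \<in> mor \<Gamma>" "dm \<Gamma> \<sigma> = f" "rg \<Gamma> \<sigma> = e"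
    by (auto simp: hom_set_def dest: T_mor)
  have f: "f \<in> obj \<Gamma> (mor \<Gamma>)" using assms by (simp add: fin_obj_def)
  have "\<exists>\<rho> \<in> hom_set \<Gamma> T f f. comp \<Gamma> (ginv \<Gamma> \<sigma>) \<tau> \<in> dcoset \<rho>" if "\<tau> \<in> hom_set \<Gamma> T f e" for \<tau>
  proof -
    have \<tau>: "\<tau> \<in> mor \<Gamma>" "dm \<Gamma> \<tau> = f" "rg \<Gamma> \<tau> = e" using that by (auto simp: hom_set_def T_mor)
    with \<sigma> have "comp \<Gamma> (ginv \<Gamma> \<sigma>) \<tau> \<in> mor \<Gamma>" by simp
    from ex_T[OF this] obtain \<rho> where "\<rho> \<in> T" "\<rho> \<in> mor \<Gamma>" "dm \<Gamma> \<rho> = dm \<Gamma> (comp \<Gamma> (ginv \<Gamma> \<sigma>) \<tau>)"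
      "rg \<Gamma> \<rho> = rg \<Gamma> (comp \<Gamma> (ginv \<Gamma> \<sigma>) \<tau>)" "comp \<Gamma> (ginv \<Gamma> \<sigma>) \<tau> \<in> dcoset \<rho>" .
    with \<sigma> \<tau> show ?thesis by (intro bexI[of _ \<rho>]) (auto simp: hom_set_def)
  qed
  then obtain \<phi> where \<phi>: "\<And>\<tau>. \<tau> \<in> hom_set \<Gamma> T f e \<Longrightarrow>
      \<phi> \<tau> \<in> hom_set \<Gamma> T f f \<and> comp \<Gamma> (ginv \<Gamma> \<sigma>) \<tau> \<in> dcoset (\<phi> \<tau>)"
    by metis
  have "inj_on \<phi> (hom_set \<Gamma> T f e)"
  proof (rule inj_onI)
    fix \<tau> \<tau>' assume *: "\<tau> \<in> hom_set \<Gamma> T f e" "\<tau>' \<in> hom_set \<Gamma> T f e" "\<phi> \<tau> = \<phi> \<tau>'"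
    then have \<tau>: "\<tau> \<in> T" "\<tau> \<in> mor \<Gamma>" "dm \<Gamma> \<tau> = f" "rg \<Gamma> \<tau> = e"
      and \<tau>': "\<tau>' \<in> T" "\<tau>' \<in> mor \<Gamma>" "dm \<Gamma> \<tau>' = f" "rg \<Gamma> \<tau>' = e"
      by (auto simp: hom_set_def T_mor)
    have "\<phi> \<tau>' \<in> mor \<Gamma>" using \<phi>[OF *(2)] by (auto simp: hom_set_def T_mor)
    then have "dcoset (comp \<Gamma> (ginv \<Gamma> \<sigma>) \<tau>) = dcoset (comp \<Gamma> (ginv \<Gamma> \<sigma>) \<tau>')"
      using \<phi>[OF *(1)] \<phi>[OF *(2)] *(3) by (metis dcoset_eq)
    then have "comp \<Gamma> (ginv \<Gamma> \<sigma>) \<tau> \<in> dcoset (comp \<Gamma> (ginv \<Gamma> \<sigma>) \<tau>')"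
      using dcoset_refl[of "comp \<Gamma> (ginv \<Gamma> \<sigma>) \<tau>"] \<sigma> \<tau> by simp
    then have "\<tau> \<in> dcoset \<tau>'"
      using dcoset_comp_left[of "ginv \<Gamma> \<sigma>" \<tau>' \<tau>] \<sigma> \<tau> \<tau>' by simp
    then show "\<tau> = \<tau>'" using T_unique \<tau> \<tau>' by simp
  qed
  moreover have "\<phi> ` hom_set \<Gamma> T f e \<subseteq> hom_set \<Gamma> T f f" using \<phi> by blast
  moreover have "finite (hom_set \<Gamma> T f f)" using fin_obj_iff[OF f] assms by blast
  ultimately show ?thesis by (rule inj_on_finite)
qed simp

end

section \<open>From the trace to a bimodule section\<close>

context relative_trace_setting
begin

text \<open>The outer sum of \<open>rel_trace\<close> runs over the objects with nonzero inner sum.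
  Any finite \<open>Q\<close> that covers the nonzero terms serves as well, and the double sum
  becomes one sum over representatives.\<close>

lemma rel_trace_eq:
  assumes Q: "finite Q" "Q \<subseteq> fin_obj \<Gamma> \<Delta>"
    and zero: "\<And>\<tau>. \<tau> \<in> T \<Longrightarrow> rg \<Gamma> \<tau> = e \<Longrightarrow> dm \<Gamma> \<tau> \<in> fin_obj \<Gamma> \<Delta> \<Longrightarrow> dm \<Gamma> \<tau> \<notin> Q \<Longrightarrow>
      gamma \<Gamma> n u v \<tau> x = 0"
  shows "rel_trace \<Gamma> \<Delta> T n u v e x =
    (\<Sum>\<tau> | \<tau> \<in> T \<and> rg \<Gamma> \<tau> = e \<and> dm \<Gamma> \<tau> \<in> Q. gamma \<Gamma> n u v \<tau> x)"
proof -
  define t where "t f = (\<Sum>\<tau> \<in> hom_set \<Gamma> T f e. gamma \<Gamma> n u v \<tau> x)" for f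
  have "t f = 0" if "f \<in> fin_obj \<Gamma> \<Delta>" "f \<notin> Q" for f
    unfolding t_def using that by (intro sum.neutral) (auto simp: hom_set_def intro: zero)
  then have "(\<Sum>f \<in> {f \<in> fin_obj \<Gamma> \<Delta>. t f \<noteq> 0}. t f) = (\<Sum>f\<in>Q. t f)"
    using Q by (intro sum.mono_neutral_left) auto
  also have "\<dots> = sum (\<lambda>\<tau>. gamma \<Gamma> n u v \<tau> x) (\<Union>f\<in>Q. hom_set \<Gamma> T f e)"
    unfolding t_def using Q finite_hom_T
    by (intro sum.UNION_disjoint[symmetric]) (auto simp: hom_set_def)
  also have "(\<Union>f\<in>Q. hom_set \<Gamma> T f e) = {\<tau> \<in> T. rg \<Gamma> \<tau> = e \<and> dm \<Gamma> \<tau> \<in> Q}"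
    by (auto simp: hom_set_def)
  finally show ?thesis
    unfolding rel_trace_def t_def[symmetric] Let_def .
qed

section \<open>Casimir elements built from an invariant\<close>

definition trace_dom :: "'r \<Rightarrow> 'g \<Rightarrow> 'g set" where
  "trace_dom r e = {\<tau> \<in> T. rg \<Gamma> \<tau> = e \<and> dm \<Gamma> \<tau> \<in> {f \<in> fin_obj \<Gamma> \<Delta>. proj {f} r \<noteq> 0}}"

text \<open>The element \<open>X\<^sub>e\<close> built from \<open>r\<close>. Its index set is
  finite: finitely many objects carry a nonzero component of \<open>r\<close>, and those of finite
  index are the domain of finitely many representatives with range \<open>e\<close>.\<close>

definition casimir :: "'r \<Rightarrow> 'g \<Rightarrow> ('r \<times> 'r) \<Rightarrow>\<^sub>0 int" where
  "casimir r e = (\<Sum>\<tau>\<in>trace_dom r e. \<Sum>i=1..n \<tau>. frag_of (u \<tau> i * r, v (ginv \<Gamma> \<tau>) i))"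

text \<open>Multiplying out \<open>u r \<otimes> v\<close> gives the terms of \<open>gamma\<close>.
  Representatives with a domain of finite index that \<open>trace_dom\<close> leaves out contribute
  0, because \<open>u r\<close> sees only the component of \<open>r\<close> at that domain.\<close>

lemma mult_free_casimir:
  assumes "r \<in> part\<^sub>0"
  shows "mult_free (casimir r e) = rel_trace \<Gamma> \<Delta> T n u v e (r :: 'r)"
proof -
  have "rel_trace \<Gamma> \<Delta> T n u v e r = (\<Sum>\<tau>\<in>trace_dom r e. gamma \<Gamma> n u v \<tau> r)"
    unfolding trace_dom_def
  proof (rule rel_trace_eq)
    show "finite {f \<in> fin_obj \<Gamma> \<Delta>. proj {f} r \<noteq> 0}"
      using finite_proj_singleton[of r] by (rule rev_finite_subset) auto
    fix \<tau> assume \<tau>: "\<tau> \<in> T" "dm \<Gamma> \<tau> \<in> fin_obj \<Gamma> \<Delta>"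
      "dm \<Gamma> \<tau> \<notin> {f \<in> fin_obj \<Gamma> \<Delta>. proj {f} r \<noteq> 0}"
    have "u \<tau> i * r = 0" if "i \<in> {1..n \<tau>}" for i
      using mult_part0[OF assms T_mor u_in[OF T_mor that]] \<tau> by simp
    then show "gamma \<Gamma> n u v \<tau> r = 0"
      by (simp add: gamma_def)
  qed auto
  then show ?thesis
    by (simp add: casimir_def mult_free_eq_frag_lift frag_lift_sum gamma_def)
qed

lemma casimir_ident:
  assumes "e \<in> obj \<Gamma> (mor \<Gamma>)"
  shows "frag_lmul (ident (R e)) (casimir r e) = casimir r e"
    and "frag_rmul (casimir r e) (ident (R e)) = casimir r e"
proof -
  have "ident (R e) * (u \<tau> i * r) = u \<tau> i * r" "v (ginv \<Gamma> \<tau>) i * ident (R e) = v (ginv \<Gamma> \<tau>) i"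
    if "\<tau> \<in> trace_dom r e" "i \<in> {1..n \<tau>}" for \<tau> i
  proof -
    have \<tau>: "\<tau> \<in> mor \<Gamma>" "rg \<Gamma> \<tau> = e" using that by (auto simp: trace_dom_def T_mor)
    show "ident (R e) * (u \<tau> i * r) = u \<tau> i * r"
      using ident_mult(1)[OF \<tau>(1) u_in[OF \<tau>(1) that(2)] \<tau>(2)] by (simp add: mult.assoc[symmetric])
    show "v (ginv \<Gamma> \<tau>) i * ident (R e) = v (ginv \<Gamma> \<tau>) i"
      using ident_mult(2)[OF _ v_in[OF \<tau>(1) that(2)]] \<tau> by simp
  qed
  then show "frag_lmul (ident (R e)) (casimir r e) = casimir r e"
    "frag_rmul (casimir r e) (ident (R e)) = casimir r e"
    unfolding casimir_def by (auto simp: frag_lmul_sum frag_rmul_sum intro!: sum.cong)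
qed

text \<open>Here \<open>\<sigma>\<tau> = \<tau>'\<kappa>\<close> with
  \<open>\<kappa> \<in> \<Lambda>\<close>, and the matrix \<open>w\<close>, with entries of degree
  \<open>\<kappa>\<close>, expresses \<open>a * u \<tau> i\<close> through the
  \<open>u \<tau>' j\<close>. The entries commute with \<open>r\<close> since
  \<open>\<kappa> \<in> \<Lambda>\<close> and pass the tensor sign since
  \<open>\<kappa> \<in> \<Delta>\<close>.\<close>

lemma casimir_term_commutes:
  assumes r: "r \<in> invariants" and a: "a \<in> R \<sigma>"
    and \<sigma>: "\<sigma> \<in> mor \<Gamma>" and \<tau>: "\<tau> \<in> mor \<Gamma>" "dm \<Gamma> \<sigma> = rg \<Gamma> \<tau>"
    and \<tau>': "\<tau>' \<in> mor \<Gamma>" "dm \<Gamma> \<tau>' = dm \<Gamma> \<tau>" "comp \<Gamma> \<sigma> \<tau> \<in> dcoset \<tau>'"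
  shows "tensor_cong (part R \<Delta>)
    (\<Sum>i=1..n \<tau>. frag_of (a * (u \<tau> i * r), v (ginv \<Gamma> \<tau>) i))
    (\<Sum>j=1..n \<tau>'. frag_of (u \<tau>' j * r, v (ginv \<Gamma> \<tau>') j * a))"
proof -
  define \<kappa> where "\<kappa> = comp \<Gamma> (ginv \<Gamma> \<tau>') (comp \<Gamma> \<sigma> \<tau>)"
  define w where "w j i = v (ginv \<Gamma> \<tau>') j * (a * u \<tau> i)" for i j
  have rg: "rg \<Gamma> \<tau>' = rg \<Gamma> \<sigma>" using \<tau>'(3) \<sigma> \<tau> by (simp add: dcoset_def)
  have \<kappa>: "\<kappa> \<in> \<Delta>" "\<kappa> \<in> Iso \<Gamma> \<Delta>"
    using \<sigma> \<tau> \<tau>' rg by (auto simp: \<kappa>_def mem_Iso dcoset_def)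
  have au: "a * u \<tau> i \<in> R (comp \<Gamma> \<sigma> \<tau>)" if "i \<in> {1..n \<tau>}" for i
    using R_mult(1)[OF \<sigma> \<tau>(1) a u_in[OF \<tau>(1) that] \<tau>(2)] .
  have w_in: "w j i \<in> R \<kappa>" if "i \<in> {1..n \<tau>}" "j \<in> {1..n \<tau>'}" for i j
    unfolding w_def \<kappa>_def using \<sigma> \<tau> \<tau>' rg
    by (intro R_mult(1) v_in that au) auto
  have w_\<Delta>: "w j i \<in> part R \<Delta>" and w_r: "w j i * r = r * w j i"
    if "i \<in> {1..n \<tau>}" "j \<in> {1..n \<tau>'}" for i j
    using homogeneous_in_part[OF \<kappa>(1) w_in[OF that]] homogeneous_in_part[OF \<kappa>(2) w_in[OF that]] r
    by (auto simp: centralizer_def)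
  \<comment> \<open>The unit at the range of \<open>\<tau>'\<close> is inserted before
    \<open>a * u \<tau> i\<close> and expanded through the decomposition at
    \<open>\<tau>'\<close>.\<close>
  have aur: "a * (u \<tau> i * r) = (\<Sum>j=1..n \<tau>'. (u \<tau>' j * r) * w j i)" if i: "i \<in> {1..n \<tau>}" for i
  proof -
    have "ident (R (rg \<Gamma> \<tau>')) * (a * u \<tau> i) = a * u \<tau> i"
      using ident_mult(1)[OF _ au[OF i]] \<sigma> \<tau> rg by simp
    then have "a * (u \<tau> i * r) = (\<Sum>j=1..n \<tau>'. u \<tau>' j * v (ginv \<Gamma> \<tau>') j) * (a * u \<tau> i) * r"
      by (simp only: sum_u_v[OF \<tau>'(1)] mult.assoc[of a])
    also have "\<dots> = (\<Sum>j=1..n \<tau>'. u \<tau>' j * (w j i * r))"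
      by (simp add: sum_distrib_right w_def mult.assoc)
    also have "\<dots> = (\<Sum>j=1..n \<tau>'. (u \<tau>' j * r) * w j i)"
      using w_r[OF i] by (intro sum.cong) (auto simp: mult.assoc)
    finally show ?thesis .
  qed
  \<comment> \<open>The sum over \<open>i\<close> collapses to the unit at the domain of
    \<open>\<sigma>\<close>, which \<open>a\<close> absorbs.\<close>
  have va: "(\<Sum>i=1..n \<tau>. w j i * v (ginv \<Gamma> \<tau>) i) = v (ginv \<Gamma> \<tau>') j * a" for j
  proof -
    have "(\<Sum>i=1..n \<tau>. w j i * v (ginv \<Gamma> \<tau>) i) =
        v (ginv \<Gamma> \<tau>') j * (a * (\<Sum>i=1..n \<tau>. u \<tau> i * v (ginv \<Gamma> \<tau>) i))"
      by (simp add: sum_distrib_left w_def mult.assoc)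
    then show ?thesis
      using ident_mult(2)[OF \<sigma> a \<tau>(2)] by (simp only: sum_u_v[OF \<tau>(1)])
  qed
  have "tensor_cong (part R \<Delta>) (\<Sum>i=1..n \<tau>. frag_of (a * (u \<tau> i * r), v (ginv \<Gamma> \<tau>) i))
      (\<Sum>i=1..n \<tau>. \<Sum>j=1..n \<tau>'. frag_of ((u \<tau>' j * r) * w j i, v (ginv \<Gamma> \<tau>) i))"
    by (intro tensor_cong_sum) (simp add: aur tensor_cong_sum_left)
  also have "tensor_cong (part R \<Delta>) \<dots>
      (\<Sum>i=1..n \<tau>. \<Sum>j=1..n \<tau>'. frag_of (u \<tau>' j * r, w j i * v (ginv \<Gamma> \<tau>) i))"
    by (intro tensor_cong_sum tensor_cong_balanced w_\<Delta>)
  also have "\<dots> = (\<Sum>j=1..n \<tau>'. \<Sum>i=1..n \<tau>. frag_of (u \<tau>' j * r, w j i * v (ginv \<Gamma> \<tau>) i))"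
    by (rule sum.swap)
  also have "tensor_cong (part R \<Delta>) \<dots> (\<Sum>j=1..n \<tau>'. frag_of (u \<tau>' j * r, v (ginv \<Gamma> \<tau>') j * a))"
    unfolding va[symmetric] by (intro tensor_cong_sum tensor_cong_sym[OF tensor_cong_sum_right])
  finally show ?thesis .
qed

text \<open>Left composition with \<open>\<sigma>\<close> permutes the cosets of
  \<open>\<Lambda>\<close> and keeps domains, so the conditions on the domain in
  \<open>trace_dom\<close> carry over.\<close>

lemma ex_trace_dom_bij:
  assumes \<sigma>: "\<sigma> \<in> mor \<Gamma>"
  shows "\<exists>\<phi>. bij_betw \<phi> (trace_dom r (dm \<Gamma> \<sigma>)) (trace_dom r (rg \<Gamma> \<sigma>)) \<and>
    (\<forall>\<tau> \<in> trace_dom r (dm \<Gamma> \<sigma>).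
      \<phi> \<tau> \<in> mor \<Gamma> \<and> dm \<Gamma> (\<phi> \<tau>) = dm \<Gamma> \<tau> \<and> comp \<Gamma> \<sigma> \<tau> \<in> dcoset (\<phi> \<tau>))"
proof -
  have ex: "\<exists>\<tau>'. \<tau>' \<in> T \<and> dm \<Gamma> \<tau>' = dm \<Gamma> \<tau> \<and> rg \<Gamma> \<tau>' = rg \<Gamma> \<rho> \<and> comp \<Gamma> \<rho> \<tau> \<in> dcoset \<tau>'"
    if "\<tau> \<in> mor \<Gamma>" "\<rho> \<in> mor \<Gamma>" "dm \<Gamma> \<rho> = rg \<Gamma> \<tau>" for \<tau> \<rho>
  proof -
    have "comp \<Gamma> \<rho> \<tau> \<in> mor \<Gamma>" using that by simp
    from ex_T[OF this] show ?thesis using that by (metis dm_comp rg_comp)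
  qed
  have dom: "\<tau> \<in> T" "\<tau> \<in> mor \<Gamma>" "rg \<Gamma> \<tau> = e" if "\<tau> \<in> trace_dom r e" for \<tau> e
    using that by (auto simp: trace_dom_def T_mor)
  have "\<forall>\<tau> \<in> trace_dom r (dm \<Gamma> \<sigma>). \<exists>\<tau>'. \<tau>' \<in> T \<and> dm \<Gamma> \<tau>' = dm \<Gamma> \<tau> \<and> rg \<Gamma> \<tau>' = rg \<Gamma> \<sigma> \<and>
      comp \<Gamma> \<sigma> \<tau> \<in> dcoset \<tau>'"
  proof (intro ballI ex \<sigma>)
    fix \<tau> assume "\<tau> \<in> trace_dom r (dm \<Gamma> \<sigma>)"
    from dom[OF this] show "\<tau> \<in> mor \<Gamma>" "dm \<Gamma> \<sigma> = rg \<Gamma> \<tau>" by simp_all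
  qed
  from bchoice[OF this] obtain \<phi> where \<phi>: "\<And>\<tau>. \<tau> \<in> trace_dom r (dm \<Gamma> \<sigma>) \<Longrightarrow>
      \<phi> \<tau> \<in> T \<and> dm \<Gamma> (\<phi> \<tau>) = dm \<Gamma> \<tau> \<and> rg \<Gamma> (\<phi> \<tau>) = rg \<Gamma> \<sigma> \<and> comp \<Gamma> \<sigma> \<tau> \<in> dcoset (\<phi> \<tau>)"
    by blast
  have "bij_betw \<phi> (trace_dom r (dm \<Gamma> \<sigma>)) (trace_dom r (rg \<Gamma> \<sigma>))"
  proof (intro bij_betw_imageI inj_onI subset_antisym subsetI)
    fix \<tau> \<tau>' assume *: "\<tau> \<in> trace_dom r (dm \<Gamma> \<sigma>)" "\<tau>' \<in> trace_dom r (dm \<Gamma> \<sigma>)" "\<phi> \<tau> = \<phi> \<tau>'"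
    have mor: "comp \<Gamma> \<sigma> \<tau> \<in> mor \<Gamma>" "comp \<Gamma> \<sigma> \<tau>' \<in> mor \<Gamma>" "\<phi> \<tau>' \<in> mor \<Gamma>"
      using \<sigma> dom[OF *(1)] dom[OF *(2)] \<phi>[OF *(2)] T_mor by auto
    have "dcoset (comp \<Gamma> \<sigma> \<tau>) = dcoset (comp \<Gamma> \<sigma> \<tau>')"
      using \<phi>[OF *(1)] \<phi>[OF *(2)] *(3) dcoset_eq[OF mor(3), of "comp \<Gamma> \<sigma> \<tau>"]
        dcoset_eq[OF mor(3), of "comp \<Gamma> \<sigma> \<tau>'"] by simp
    then have "comp \<Gamma> \<sigma> \<tau> \<in> dcoset (comp \<Gamma> \<sigma> \<tau>')"
      using dcoset_refl[OF mor(1)] by simp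
    moreover have "\<tau> \<in> dcoset \<tau>' \<longleftrightarrow> comp \<Gamma> \<sigma> \<tau> \<in> dcoset (comp \<Gamma> \<sigma> \<tau>')"
      by (rule dcoset_comp_left) (simp_all only: \<sigma> dom[OF *(1)] dom[OF *(2)])
    ultimately have "\<tau> \<in> dcoset \<tau>'" by blast
    moreover have "dm \<Gamma> \<tau> = dm \<Gamma> \<tau>'" using \<phi>[OF *(1)] \<phi>[OF *(2)] *(3) by simp
    ultimately show "\<tau> = \<tau>'"
      using T_unique dom(1)[OF *(1)] dom(1)[OF *(2)] by blast
  next
    fix \<tau>' assume "\<tau>' \<in> \<phi> ` trace_dom r (dm \<Gamma> \<sigma>)"
    then obtain \<tau> where \<tau>: "\<tau> \<in> trace_dom r (dm \<Gamma> \<sigma>)" "\<tau>' = \<phi> \<tau>" by blast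
    with \<phi>[OF \<tau>(1)] show "\<tau>' \<in> trace_dom r (rg \<Gamma> \<sigma>)"
      by (simp add: trace_dom_def)
  next
    fix \<tau>' assume \<tau>': "\<tau>' \<in> trace_dom r (rg \<Gamma> \<sigma>)"
    \<comment> \<open>The preimage of \<open>\<tau>'\<close> is the representative of
      \<open>\<sigma>\<inverse>\<tau>'\<close>.\<close>
    have "\<exists>\<tau>. \<tau> \<in> T \<and> dm \<Gamma> \<tau> = dm \<Gamma> \<tau>' \<and> rg \<Gamma> \<tau> = rg \<Gamma> (ginv \<Gamma> \<sigma>) \<and>
        comp \<Gamma> (ginv \<Gamma> \<sigma>) \<tau>' \<in> dcoset \<tau>"
      by (rule ex) (use dom[OF \<tau>'] \<sigma> in auto)
    then obtain \<tau> where \<tau>: "\<tau> \<in> T" "dm \<Gamma> \<tau> = dm \<Gamma> \<tau>'" "rg \<Gamma> \<tau> = dm \<Gamma> \<sigma>"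
      "comp \<Gamma> (ginv \<Gamma> \<sigma>) \<tau>' \<in> dcoset \<tau>" "\<tau> \<in> mor \<Gamma>"
      using \<sigma> T_mor by auto
    then have \<tau>_dom: "\<tau> \<in> trace_dom r (dm \<Gamma> \<sigma>)" using \<tau>' by (simp add: trace_dom_def)
    note \<phi>\<tau> = \<phi>[OF \<tau>_dom]
    have "comp \<Gamma> \<sigma> (comp \<Gamma> (ginv \<Gamma> \<sigma>) \<tau>') \<in> dcoset (comp \<Gamma> \<sigma> \<tau>)"
      using \<tau> \<sigma> dom[OF \<tau>'] by (intro iffD1[OF dcoset_comp_left]) auto
    then have "\<tau>' \<in> dcoset (comp \<Gamma> \<sigma> \<tau>)" using \<sigma> dom[OF \<tau>'] by simp
    also have "dcoset (comp \<Gamma> \<sigma> \<tau>) = dcoset (\<phi> \<tau>)"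
      using \<phi>\<tau> T_mor by (intro dcoset_eq) auto
    finally have "\<tau>' = \<phi> \<tau>" using T_unique dom[OF \<tau>'] \<phi>\<tau> \<tau> by simp
    then show "\<tau>' \<in> \<phi> ` trace_dom r (dm \<Gamma> \<sigma>)" using \<tau>_dom by blast
  qed
  then show ?thesis using \<phi> T_mor by (intro exI[of _ \<phi>]) blast
qed

lemma casimir_commutes:
  assumes r: "r \<in> invariants" and \<sigma>: "\<sigma> \<in> mor \<Gamma>" and a: "a \<in> R \<sigma>"
  shows "tensor_cong (part R \<Delta>)
    (frag_lmul a (casimir r (dm \<Gamma> \<sigma>))) (frag_rmul (casimir r (rg \<Gamma> \<sigma>)) a)"
proof -
  from ex_trace_dom_bij[OF \<sigma>, of r] obtain \<phi> where
    bij: "bij_betw \<phi> (trace_dom r (dm \<Gamma> \<sigma>)) (trace_dom r (rg \<Gamma> \<sigma>))" and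
    \<phi>: "\<forall>\<tau> \<in> trace_dom r (dm \<Gamma> \<sigma>).
      \<phi> \<tau> \<in> mor \<Gamma> \<and> dm \<Gamma> (\<phi> \<tau>) = dm \<Gamma> \<tau> \<and> comp \<Gamma> \<sigma> \<tau> \<in> dcoset (\<phi> \<tau>)"
    by (elim exE conjE)
  have "frag_lmul a (casimir r (dm \<Gamma> \<sigma>)) =
      (\<Sum>\<tau>\<in>trace_dom r (dm \<Gamma> \<sigma>). \<Sum>i=1..n \<tau>. frag_of (a * (u \<tau> i * r), v (ginv \<Gamma> \<tau>) i))"
    by (simp add: casimir_def frag_lmul_sum)
  also have "tensor_cong (part R \<Delta>) \<dots> (\<Sum>\<tau>\<in>trace_dom r (dm \<Gamma> \<sigma>).
      \<Sum>j=1..n (\<phi> \<tau>). frag_of (u (\<phi> \<tau>) j * r, v (ginv \<Gamma> (\<phi> \<tau>)) j * a))"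
  proof (intro tensor_cong_sum casimir_term_commutes[OF r a \<sigma>])
    fix \<tau> assume \<tau>: "\<tau> \<in> trace_dom r (dm \<Gamma> \<sigma>)"
    then show "\<tau> \<in> mor \<Gamma>" "dm \<Gamma> \<sigma> = rg \<Gamma> \<tau>" by (auto simp: trace_dom_def T_mor)
    show "\<phi> \<tau> \<in> mor \<Gamma>" "dm \<Gamma> (\<phi> \<tau>) = dm \<Gamma> \<tau>" "comp \<Gamma> \<sigma> \<tau> \<in> dcoset (\<phi> \<tau>)"
      using bspec[OF \<phi> \<tau>] by simp_all
  qed
  also have "\<dots> = (\<Sum>\<tau>\<in>trace_dom r (rg \<Gamma> \<sigma>). \<Sum>j=1..n \<tau>. frag_of (u \<tau> j * r, v (ginv \<Gamma> \<tau>) j * a))"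
    by (rule sum.reindex_bij_betw[OF bij])
  also have "\<dots> = frag_rmul (casimir r (rg \<Gamma> \<sigma>)) a"
    by (simp add: casimir_def frag_rmul_sum)
  finally show ?thesis .
qed

text \<open>Multiplying out \<open>casimir_commutes\<close> yields \<open>a t = t' a\<close> for the
  traces \<open>t\<close> and \<open>t'\<close> at the two ends. If \<open>t\<close> is the unit,
  then \<open>t'\<close> fixes every \<open>u \<sigma> i\<close> from the left, hence also the unit
  \<open>\<Sum> u v\<close>.\<close>

lemma rel_trace_transport:
  assumes r: "r \<in> invariants" and \<sigma>: "\<sigma> \<in> mor \<Gamma>"
    and tr: "rel_trace \<Gamma> \<Delta> T n u v (dm \<Gamma> \<sigma>) r = ident (R (dm \<Gamma> \<sigma>))"
  shows "rel_trace \<Gamma> \<Delta> T n u v (rg \<Gamma> \<sigma>) r = ident (R (rg \<Gamma> \<sigma>))"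
proof -
  have r0: "r \<in> part\<^sub>0" using r by (simp add: centralizer_def)
  let ?t = "rel_trace \<Gamma> \<Delta> T n u v (rg \<Gamma> \<sigma>) r"
  have "a = ?t * a" if a: "a \<in> R \<sigma>" for a
  proof -
    have "a * mult_free (casimir r (dm \<Gamma> \<sigma>)) = mult_free (casimir r (rg \<Gamma> \<sigma>)) * a"
      using mult_free_tensor_cong[OF casimir_commutes[OF r \<sigma> a]]
      by (simp add: mult_free_eq_frag_lift frag_lift_frag_lmul frag_lift_frag_rmul
          frag_lift_mult_left frag_lift_mult_right mult.assoc case_prod_unfold)
    then show ?thesis
      using ident_mult(2)[OF \<sigma> a] by (simp add: mult_free_casimir[OF r0] tr)
  qed
  then have "?t * u \<sigma> i = u \<sigma> i" if "i \<in> {1..n \<sigma>}" for i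
    using u_in[OF \<sigma> that] by simp
  then have "?t * (\<Sum>i=1..n \<sigma>. u \<sigma> i * v (ginv \<Gamma> \<sigma>) i) = (\<Sum>i=1..n \<sigma>. u \<sigma> i * v (ginv \<Gamma> \<sigma>) i)"
    by (simp add: sum_distrib_left mult.assoc[symmetric])
  then have "?t * ident (R (rg \<Gamma> \<sigma>)) = ident (R (rg \<Gamma> \<sigma>))"
    by (simp only: sum_u_v[OF \<sigma>])
  \<comment> \<open>The second factors of the Casimir element absorb the unit, so the trace does
    too.\<close>
  moreover have "?t * ident (R (rg \<Gamma> \<sigma>)) = mult_free (frag_rmul (casimir r (rg \<Gamma> \<sigma>)) (ident (R (rg \<Gamma> \<sigma>))))"
    by (simp add: mult_free_eq_frag_lift frag_lift_frag_rmul frag_lift_mult_right mult.assoc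
        case_prod_unfold flip: mult_free_casimir[OF r0])
  moreover have "\<dots> = ?t"
    by (simp add: casimir_ident(2)[OF rg_obj[OF \<sigma>]] mult_free_casimir[OF r0])
  ultimately show ?thesis by simp
qed

text \<open>
  The bimodule section is \<open>a \<mapsto> a X\<close>, where \<open>X\<close> is the formal sum of the \<open>X e\<close> over all objects;
  only the finitely many \<open>e\<close> with \<open>a 1\<^sub>e \<noteq> 0\<close> contribute.
\<close>

lemma separable_if_local_casimir:
  assumes X_ident: "\<And>e. e \<in> obj \<Gamma> (mor \<Gamma>) \<Longrightarrow> frag_lmul (ident (R e)) (X e) = X e"
      "\<And>e. e \<in> obj \<Gamma> (mor \<Gamma>) \<Longrightarrow> frag_rmul (X e) (ident (R e)) = X e"
    and X_commutes: "\<And>\<sigma> a. \<sigma> \<in> mor \<Gamma> \<Longrightarrow> a \<in> R \<sigma> \<Longrightarrow>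
      tensor_cong (part R \<Delta>) (frag_lmul a (X (dm \<Gamma> \<sigma>))) (frag_rmul (X (rg \<Gamma> \<sigma>)) a)"
    and X_mult: "\<And>e. e \<in> obj \<Gamma> (mor \<Gamma>) \<Longrightarrow> mult_free (X e) = ident (R e)"
  shows "separable_extension (part R \<Delta>)"
proof -
  let ?S = "part R \<Delta>"
  let ?O = "obj \<Gamma> (mor \<Gamma>)"
  \<comment> \<open>Finitely many objects, because a homogeneous element has a nonzero product only
    with the unit at its domain.\<close>
  define Ob where "Ob a = {e \<in> ?O. a * ident (R e) \<noteq> 0}" for a
  define D where "D a = (\<Sum>e\<in>Ob a. frag_lmul a (X e))" for a
  have lmul_zero: "tensor_cong ?S (frag_lmul 0 c) 0" for c
    using tensor_cong_sym[OF frag_lmul_add_left[of ?S 0 0 c]] by (simp add: tensor_cong_def)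
  have rmul_zero: "tensor_cong ?S (frag_rmul c 0) 0" for c
    using tensor_cong_sym[OF frag_rmul_add_right[of ?S c 0 0]] by (simp add: tensor_cong_def)
  have X_left: "tensor_cong ?S (frag_lmul a (X e)) 0" if "e \<in> ?O" "a * ident (R e) = 0" for a e
    using frag_lmul_lmul[of a "ident (R e)" "X e"] X_ident(1)[OF that(1)] lmul_zero[of "X e"] that(2)
    by simp
  have X_right: "tensor_cong ?S (frag_rmul (X e) a) 0" if "e \<in> ?O" "ident (R e) * a = 0" for a e
  proof -
    have "frag_rmul (frag_rmul c b) a = frag_rmul c (b * a)" for b c
      by (induction c rule: frag_pair_induct) (auto simp: mult.assoc)
    then show ?thesis
      using X_ident(2)[OF that(1)] rmul_zero[of "X e"] that(2) by metis
  qed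
  have fin: "finite (Ob a)" for a
  proof (induction a rule: graded_induct)
    case (homogeneous \<sigma> a)
    then have "Ob a \<subseteq> {dm \<Gamma> \<sigma>}"
      using ident_mult_zero(2) by (auto simp: Ob_def)
    then show ?case by (rule finite_subset) simp
  next
    case (add a b)
    have "Ob (a + b) \<subseteq> Ob a \<union> Ob b" by (auto simp: Ob_def distrib_right)
    then show ?case using add by (auto intro: finite_subset)
  qed (simp add: Ob_def)
  \<comment> \<open>Summands outside \<open>Ob a\<close> are congruent to 0 but need not be the
    formal sum 0. Enlarging the index set up to congruence makes the sums for different elements
    comparable.\<close>
  have D_eq: "tensor_cong ?S (D a) (\<Sum>e\<in>A. frag_lmul a (X e))"
    if "finite A" "A \<subseteq> ?O" "Ob a \<subseteq> A" for a A
  proof -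
    have "(\<Sum>e\<in>A. frag_lmul a (X e)) = D a + (\<Sum>e\<in>A - Ob a. frag_lmul a (X e))"
      unfolding D_def using that by (subst sum.subset_diff[of "Ob a" A]) (auto simp: add.commute)
    moreover have "tensor_cong ?S (\<Sum>e\<in>A - Ob a. frag_lmul a (X e)) (\<Sum>e\<in>A - Ob a. 0)"
      using that by (intro tensor_cong_sum X_left) (auto simp: Ob_def)
    ultimately show ?thesis
      using tensor_cong_sym[OF tensor_cong_add[OF tensor_cong_refl]] by fastforce
  qed
  have Ob_obj: "Ob a \<subseteq> ?O" for a by (auto simp: Ob_def)
  have D_single: "tensor_cong ?S (\<Sum>e\<in>A. c e) (c e)"
    if "finite A" "e \<in> A" "\<And>e'. e' \<in> A \<Longrightarrow> e' \<noteq> e \<Longrightarrow> tensor_cong ?S (c e') 0" for A c e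
  proof -
    have "tensor_cong ?S (\<Sum>e'\<in>A - {e}. c e') (\<Sum>e'\<in>A - {e}. 0)"
      using that by (intro tensor_cong_sum) auto
    from tensor_cong_add[OF tensor_cong_refl this, of "c e"]
    show ?thesis using sum.remove[OF that(1,2), of c] by simp
  qed
  have D_add: "tensor_cong ?S (D (a + b)) (D a + D b)" for a b
  proof -
    define A where "A = Ob a \<union> Ob b \<union> Ob (a + b)"
    have A: "finite A" "A \<subseteq> ?O" "Ob a \<subseteq> A" "Ob b \<subseteq> A" "Ob (a + b) \<subseteq> A"
      using fin Ob_obj by (auto simp: A_def)
    have "tensor_cong ?S (D (a + b)) (\<Sum>e\<in>A. frag_lmul (a + b) (X e))"
      by (rule D_eq) (use A in auto)
    also have "tensor_cong ?S \<dots> (\<Sum>e\<in>A. frag_lmul a (X e) + frag_lmul b (X e))"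
      by (intro tensor_cong_sum frag_lmul_add_left)
    also have "\<dots> = (\<Sum>e\<in>A. frag_lmul a (X e)) + (\<Sum>e\<in>A. frag_lmul b (X e))"
      by (rule sum.distrib)
    also have "tensor_cong ?S \<dots> (D a + D b)"
      by (intro tensor_cong_add tensor_cong_sym[OF D_eq]) (use A in auto)
    finally show ?thesis .
  qed
  have D_left: "tensor_cong ?S (D (a * b)) (frag_lmul a (D b))" for a b
  proof -
    have "Ob (a * b) \<subseteq> Ob b" by (auto simp: Ob_def mult.assoc)
    then have "tensor_cong ?S (D (a * b)) (\<Sum>e\<in>Ob b. frag_lmul (a * b) (X e))"
      using fin Ob_obj by (intro D_eq)
    then show ?thesis by (simp add: D_def frag_lmul_sum frag_lmul_lmul)
  qed
  have D_right: "tensor_cong ?S (D (b * a)) (frag_rmul (D b) a)" for a b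
  proof (induction a rule: graded_induct)
    case (homogeneous \<sigma> a)
    \<comment> \<open>For \<open>a\<close> of degree \<open>\<sigma>\<close>, only the domain of
      \<open>\<sigma>\<close> survives in the sum of the \<open>b a X e\<close> and only its range
      in the sum of the \<open>b (X e) a\<close>; \<open>X_commutes\<close> matches these two
      terms.\<close>
    define A where "A = Ob (b * a) \<union> Ob b \<union> {dm \<Gamma> \<sigma>, rg \<Gamma> \<sigma>}"
    have A: "finite A" "A \<subseteq> ?O" "Ob (b * a) \<subseteq> A" "Ob b \<subseteq> A" "dm \<Gamma> \<sigma> \<in> A" "rg \<Gamma> \<sigma> \<in> A"
      using fin Ob_obj homogeneous(1) dm_obj rg_obj by (auto simp: A_def)
    have "tensor_cong ?S (D (b * a)) (\<Sum>e\<in>A. frag_lmul (b * a) (X e))"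
      by (rule D_eq) (use A in auto)
    also have "tensor_cong ?S \<dots> (frag_lmul (b * a) (X (dm \<Gamma> \<sigma>)))"
    proof (rule D_single)
      fix e assume "e \<in> A" "e \<noteq> dm \<Gamma> \<sigma>"
      then have "a * ident (R e) = 0"
        using A homogeneous ident_mult_zero(2)[of e \<sigma> a] by auto
      then show "tensor_cong ?S (frag_lmul (b * a) (X e)) 0"
        using A \<open>e \<in> A\<close> by (intro X_left) (auto simp: mult.assoc)
    qed (use A in auto)
    also have "\<dots> = frag_lmul b (frag_lmul a (X (dm \<Gamma> \<sigma>)))"
      by (simp add: frag_lmul_lmul)
    also have "tensor_cong ?S \<dots> (frag_lmul b (frag_rmul (X (rg \<Gamma> \<sigma>)) a))"
      by (intro frag_lmul_cong X_commutes homogeneous)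
    also have "tensor_cong ?S \<dots> (\<Sum>e\<in>A. frag_lmul b (frag_rmul (X e) a))"
    proof (rule tensor_cong_sym, rule D_single)
      fix e assume "e \<in> A" "e \<noteq> rg \<Gamma> \<sigma>"
      then have "ident (R e) * a = 0"
        using A homogeneous ident_mult_zero(1)[of e \<sigma> a] by auto
      then show "tensor_cong ?S (frag_lmul b (frag_rmul (X e) a)) 0"
        using A \<open>e \<in> A\<close> frag_lmul_cong[OF X_right[of e a], of b] by auto
    qed (use A in auto)
    also have "\<dots> = frag_rmul (\<Sum>e\<in>A. frag_lmul b (X e)) a"
      by (simp add: frag_rmul_sum frag_lmul_rmul)
    also have "tensor_cong ?S \<dots> (frag_rmul (D b) a)"
      by (intro frag_rmul_cong tensor_cong_sym[OF D_eq]) (use A in auto)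
    finally show ?case .
  next
    case zero
    have "D 0 = 0" by (simp add: D_def Ob_def)
    then show ?case using tensor_cong_sym[OF rmul_zero[of "D b"]] by simp
  next
    case (add a a')
    have "tensor_cong ?S (D (b * (a + a'))) (D (b * a) + D (b * a'))"
      unfolding distrib_left by (rule D_add)
    also have "tensor_cong ?S \<dots> (frag_rmul (D b) a + frag_rmul (D b) a')"
      by (intro tensor_cong_add add)
    also have "tensor_cong ?S \<dots> (frag_rmul (D b) (a + a'))"
      by (rule tensor_cong_sym[OF frag_rmul_add_right])
    finally show ?case .
  qed
  have D_mult: "mult_free (D a) = a" for a
  proof (induction a rule: graded_induct)
    case (homogeneous \<sigma> a)
    have "tensor_cong ?S (D a) (\<Sum>e\<in>{dm \<Gamma> \<sigma>}. frag_lmul a (X e))"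
      using ident_mult_zero(2)[OF _ homogeneous] dm_obj[OF homogeneous(1)]
      by (intro D_eq) (auto simp: Ob_def)
    then have "mult_free (D a) = a * mult_free (X (dm \<Gamma> \<sigma>))"
      by (auto dest!: mult_free_tensor_cong simp: mult_free_eq_frag_lift frag_lift_frag_lmul
          frag_lift_mult_left mult.assoc case_prod_unfold)
    then show ?case
      using X_mult[OF dm_obj[OF homogeneous(1)]] ident_mult(2)[OF homogeneous] by simp
  next
    case zero
    show ?case by (simp add: D_def Ob_def mult_free_eq_frag_lift)
  next
    case (add a b)
    then show ?case
      using mult_free_tensor_cong[OF D_add[of a b]] by (simp add: mult_free_eq_frag_lift frag_lift_add)
  qed
  show ?thesis
    unfolding separable_extension_iff
    using is_subring_part[OF \<Delta>_subset comp_\<Delta>] D_add D_left D_right D_mult by blast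
qed

text \<open>One \<open>r\<close> is chosen for each connected component of \<open>\<Gamma>\<close>,
  so that both ends of an arrow use the same \<open>r\<close>, as in
  \<open>casimir_commutes\<close>.\<close>

lemma separable_if_trace:
  assumes "\<forall>e \<in> obj \<Gamma> (mor \<Gamma>). \<exists>f \<in> obj_class \<Gamma> e. \<exists>r \<in> invariants.
    rel_trace \<Gamma> \<Delta> T n u v f r = ident (R f)"
  shows "separable_extension (part R \<Delta>)"
proof -
  define good where "good C r \<longleftrightarrow> r \<in> invariants \<and> (\<exists>f\<in>C. rel_trace \<Gamma> \<Delta> T n u v f r = ident (R f))"
    for C r
  \<comment> \<open>The choice sees \<open>e\<close> only through its class and is therefore
    constant on components.\<close>
  define \<rho> where "\<rho> e = (SOME r. good (obj_class \<Gamma> e) r)" for e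
  have \<rho>: "good (obj_class \<Gamma> e) (\<rho> e)" if "e \<in> obj \<Gamma> (mor \<Gamma>)" for e
  proof -
    from bspec[OF assms that] obtain f r where "f \<in> obj_class \<Gamma> e" "r \<in> invariants"
      "rel_trace \<Gamma> \<Delta> T n u v f r = ident (R f)" by (elim bexE)
    then have "good (obj_class \<Gamma> e) r" unfolding good_def by (intro conjI bexI)
    then show ?thesis unfolding \<rho>_def by (rule someI)
  qed
  show ?thesis
  proof (rule separable_if_local_casimir[of "\<lambda>e. casimir (\<rho> e) e"])
    fix \<sigma> a assume \<sigma>: "\<sigma> \<in> mor \<Gamma>" and a: "a \<in> R \<sigma>"
    have "\<rho> (dm \<Gamma> \<sigma>) = \<rho> (rg \<Gamma> \<sigma>)" unfolding \<rho>_def using obj_class_eq[OF \<sigma>] by simp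
    moreover have "\<rho> (dm \<Gamma> \<sigma>) \<in> invariants"
      using \<rho>[OF dm_obj[OF \<sigma>]] by (simp add: good_def)
    ultimately show "tensor_cong (part R \<Delta>) (frag_lmul a (casimir (\<rho> (dm \<Gamma> \<sigma>)) (dm \<Gamma> \<sigma>)))
        (frag_rmul (casimir (\<rho> (rg \<Gamma> \<sigma>)) (rg \<Gamma> \<sigma>)) a)"
      using casimir_commutes[OF _ \<sigma> a] by metis
  next
    fix e assume e: "e \<in> obj \<Gamma> (mor \<Gamma>)"
    from \<rho>[OF e] obtain f where f: "\<rho> e \<in> invariants" "f \<in> obj_class \<Gamma> e"
      "rel_trace \<Gamma> \<Delta> T n u v f (\<rho> e) = ident (R f)" by (auto simp: good_def)
    then obtain \<sigma> where \<sigma>: "\<sigma> \<in> mor \<Gamma>" "dm \<Gamma> \<sigma> = e" "rg \<Gamma> \<sigma> = f" unfolding mem_obj_class by blast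
    \<comment> \<open>The trace condition is known at some \<open>f\<close> in the class and is
      carried back to \<open>e\<close>.\<close>
    have "rel_trace \<Gamma> \<Delta> T n u v e (\<rho> e) = ident (R e)"
      using rel_trace_transport[OF f(1), of "ginv \<Gamma> \<sigma>"] \<sigma> f(3) by simp
    then show "mult_free (casimir (\<rho> e) e) = ident (R e)"
      using f(1) by (simp add: mult_free_casimir centralizer_def)
  qed (simp_all add: casimir_ident)
qed

end

section \<open>From a bimodule section to the trace\<close>

text \<open>\<open>D x\<close> is a formal sum that represents the value at \<open>x\<close> of a
  bimodule section, whence the congruences.\<close>

locale separable_setting = relative_trace_setting \<Gamma> R \<Delta> T n u v
  for \<Gamma> :: "'g cat" and R :: "'g \<Rightarrow> 'r::ring set" and \<Delta> T n u v +
  fixes D :: "'r \<Rightarrow> ('r \<times> 'r) \<Rightarrow>\<^sub>0 int"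
  assumes D_left: "tensor_cong (part R \<Delta>) (D (a * x)) (frag_lmul a (D x))"
    and D_right: "tensor_cong (part R \<Delta>) (D (x * a)) (frag_rmul (D x) a)"
    and D_mult: "mult_free (D x) = x"
begin

section \<open>Contributions of single cosets\<close>

definition coset_part :: "'g \<Rightarrow> 'r \<times> 'r \<Rightarrow> 'r" where
  "coset_part \<tau> = (\<lambda>(x, y). proj (dcoset \<tau>) x * y)"

text \<open>
  The contribution of the coset \<open>\<tau>\<Delta>\<close> to \<open>\<mu>(\<delta>(1\<^sub>e)) = 1\<^sub>e\<close>, where \<open>e\<close> is the range of \<open>\<tau>\<close>. Well
  definedness rests on projection to a union of cosets being right \<open>R\<^sub>\<Delta>\<close>-linear.
\<close>

definition coset_value :: "'g \<Rightarrow> 'r" where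
  "coset_value \<tau> = frag_lift (coset_part \<tau>) (D (ident (R (rg \<Gamma> \<tau>))))"

text \<open>The \<open>c(\<tau>)\<close> of the introduction. \<open>coset_value\<close> need not be
  homogeneous; its part of degree \<open>rg \<Gamma> \<tau>\<close> lies in
  \<open>R\<^sub>0\<close>, where \<open>r\<close> has to be found.\<close>

definition coset_trace :: "'g \<Rightarrow> 'r" where
  "coset_trace \<tau> = proj {rg \<Gamma> \<tau>} (coset_value \<tau>)"

text \<open>Right composition with \<open>\<Delta>\<close> neither enters nor leaves
  \<open>\<tau>\<Delta>\<close>, so the projection commutes with right multiplication by
  \<open>R\<^sub>\<Delta>\<close>; this is the balancing condition of the universal
  property.\<close>

lemma frag_lift_coset_part_cong:
  assumes "\<tau> \<in> mor \<Gamma>" "tensor_cong (part R \<Delta>) c d"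
  shows "frag_lift (coset_part \<tau>) c = frag_lift (coset_part \<tau>) d"
  using assms(2)
proof (rule frag_lift_tensor_cong)
  fix x s y assume "s \<in> part R \<Delta>"
  from this \<Delta>_subset have "proj (dcoset \<tau>) (x * s) = proj (dcoset \<tau>) x * s"
  proof (induction rule: part_induct)
    case (homogeneous \<delta> s)
    then show ?case
      by (intro proj_mult_right[of \<delta>] dcoset_comp_right assms(1)) (auto simp: \<Delta>_mor)
  qed (simp_all add: distrib_left proj_add)
  then show "coset_part \<tau> (x * s, y) = coset_part \<tau> (x, s * y)"
    by (simp add: coset_part_def mult.assoc)
qed (simp_all add: coset_part_def proj_add distrib_left distrib_right)

text \<open>As \<open>a\<close> absorbs the units at both ends, \<open>a D(1)\<close> and
  \<open>D(1) a\<close>, with the unit at the matching end, represent the same element of the tensor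
  square. Left multiplication by \<open>a\<close> turns the projection onto
  \<open>\<tau>\<Delta>\<close> into that onto \<open>\<rho>\<tau>\<Delta>\<close>.\<close>

lemma coset_value_commutes:
  assumes \<rho>: "\<rho> \<in> mor \<Gamma>" and \<tau>: "\<tau> \<in> mor \<Gamma>" and dm: "dm \<Gamma> \<rho> = rg \<Gamma> \<tau>" and a: "a \<in> R \<rho>"
  shows "a * coset_value \<tau> = coset_value (comp \<Gamma> \<rho> \<tau>) * a"
proof -
  let ?\<sigma> = "comp \<Gamma> \<rho> \<tau>"
  have \<sigma>: "?\<sigma> \<in> mor \<Gamma>" using assms by simp
  have "proj (dcoset ?\<sigma>) (a * x) = a * proj (dcoset \<tau>) x" for x
    by (rule proj_mult_left[OF \<rho> a]) (use \<rho> \<tau> dm dcoset_comp_left in auto)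
  then have "a * coset_value \<tau> = frag_lift (coset_part ?\<sigma>) (frag_lmul a (D (ident (R (rg \<Gamma> \<tau>)))))"
    by (simp add: coset_value_def coset_part_def frag_lift_mult_left frag_lift_frag_lmul
        case_prod_unfold mult.assoc)
  also have "\<dots> = frag_lift (coset_part ?\<sigma>) (D (a * ident (R (rg \<Gamma> \<tau>))))"
    by (rule frag_lift_coset_part_cong[OF \<sigma> tensor_cong_sym[OF D_left]])
  also have "a * ident (R (rg \<Gamma> \<tau>)) = ident (R (rg \<Gamma> \<rho>)) * a"
    using ident_mult(1)[OF \<rho> a refl] ident_mult(2)[OF \<rho> a dm] by simp
  also have "frag_lift (coset_part ?\<sigma>) (D (ident (R (rg \<Gamma> \<rho>)) * a)) =
      frag_lift (coset_part ?\<sigma>) (frag_rmul (D (ident (R (rg \<Gamma> \<rho>)))) a)"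
    by (rule frag_lift_coset_part_cong[OF \<sigma> D_right])
  also have "\<dots> = coset_value ?\<sigma> * a"
    using assms by (simp add: coset_value_def coset_part_def frag_lift_mult_right
        frag_lift_frag_rmul case_prod_unfold mult.assoc)
  finally show ?thesis .
qed

lemma coset_trace_in: "\<tau> \<in> mor \<Gamma> \<Longrightarrow> coset_trace \<tau> \<in> R (rg \<Gamma> \<tau>)"
  unfolding coset_trace_def by (rule proj_singleton_in) simp

text \<open>The parts of degree \<open>\<rho>\<close> are compared in
  \<open>coset_value_commutes\<close>: on either side of \<open>\<rho>\<close>, only the identity
  composes with it to \<open>\<rho>\<close>.\<close>

lemma coset_trace_commutes:
  assumes \<rho>: "\<rho> \<in> mor \<Gamma>" and \<tau>: "\<tau> \<in> mor \<Gamma>" and dm: "dm \<Gamma> \<rho> = rg \<Gamma> \<tau>" and a: "a \<in> R \<rho>"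
  shows "a * coset_trace \<tau> = coset_trace (comp \<Gamma> \<rho> \<tau>) * a"
proof -
  have "\<sigma> = dm \<Gamma> \<rho> \<longleftrightarrow> comp \<Gamma> \<rho> \<sigma> = \<rho>" if "\<sigma> \<in> mor \<Gamma>" "dm \<Gamma> \<rho> = rg \<Gamma> \<sigma>" for \<sigma>
  proof
    assume "comp \<Gamma> \<rho> \<sigma> = \<rho>"
    then have "comp \<Gamma> (ginv \<Gamma> \<rho>) (comp \<Gamma> \<rho> \<sigma>) = dm \<Gamma> \<rho>" using \<rho> by simp
    then show "\<sigma> = dm \<Gamma> \<rho>" using \<rho> that by simp
  qed (use \<rho> in simp)
  then have left: "proj {\<rho>} (a * x) = a * proj {dm \<Gamma> \<rho>} x" for x
    by (intro proj_mult_left[OF \<rho> a]) auto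
  have "\<sigma> = rg \<Gamma> \<rho> \<longleftrightarrow> comp \<Gamma> \<sigma> \<rho> = \<rho>" if "\<sigma> \<in> mor \<Gamma>" "dm \<Gamma> \<sigma> = rg \<Gamma> \<rho>" for \<sigma>
  proof
    assume *: "comp \<Gamma> \<sigma> \<rho> = \<rho>"
    have "comp \<Gamma> (comp \<Gamma> \<sigma> \<rho>) (ginv \<Gamma> \<rho>) = rg \<Gamma> \<rho>" unfolding * using \<rho> by simp
    then show "\<sigma> = rg \<Gamma> \<rho>" using \<rho> that by simp
  qed (use \<rho> in simp)
  then have right: "proj {\<rho>} (x * a) = proj {rg \<Gamma> \<rho>} x * a" for x
    by (intro proj_mult_right[OF \<rho> a]) auto
  show ?thesis
    using left[of "coset_value \<tau>"] right[of "coset_value (comp \<Gamma> \<rho> \<tau>)"]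
      coset_value_commutes[OF assms] assms by (simp add: coset_trace_def)
qed

lemma coset_trace_cong:
  assumes "\<sigma> \<in> mor \<Gamma>" "\<tau> \<in> dcoset \<sigma>" shows "coset_trace \<tau> = coset_trace \<sigma>"
  using dcoset_eq[OF assms] assms(2)
  by (simp add: coset_trace_def coset_value_def coset_part_def dcoset_def[of \<sigma>])

text \<open>Moving each \<open>u \<tau> i\<close> past the coset trace turns \<open>c\<close> at the
  domain into \<open>c(\<tau>)\<close>; then \<open>\<Sum> u v\<close> is the unit.\<close>

lemma gamma_coset_trace:
  assumes "\<tau> \<in> mor \<Gamma>"
  shows "gamma \<Gamma> n u v \<tau> (coset_trace (dm \<Gamma> \<tau>)) = coset_trace \<tau>"
proof -
  have "gamma \<Gamma> n u v \<tau> (coset_trace (dm \<Gamma> \<tau>)) =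
      (\<Sum>i=1..n \<tau>. coset_trace \<tau> * (u \<tau> i * v (ginv \<Gamma> \<tau>) i))"
    unfolding gamma_def
    using coset_trace_commutes[OF assms dm_mor[OF assms] _ u_in[OF assms]] assms
    by (intro sum.cong) (auto simp: mult.assoc)
  also have "\<dots> = coset_trace \<tau> * ident (R (rg \<Gamma> \<tau>))"
    unfolding sum_u_v[OF assms, symmetric] sum_distrib_left ..
  also have "\<dots> = coset_trace \<tau>"
    using ident_mult(2)[OF _ coset_trace_in[OF assms]] assms by simp
  finally show ?thesis .
qed

text \<open>One direction applies \<open>gamma\<close>. For the other,
  \<open>a c(\<tau>) = c(\<tau>\<inverse>\<tau>) a\<close> for \<open>a\<close> of degree
  \<open>\<tau>\<inverse>\<close>, and the unit at the domain is a sum of products that begin with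
  such \<open>a\<close>.\<close>

lemma coset_trace_eq_0_iff:
  assumes "\<tau> \<in> mor \<Gamma>"
  shows "coset_trace \<tau> = 0 \<longleftrightarrow> coset_trace (dm \<Gamma> \<tau>) = 0"
proof
  assume "coset_trace (dm \<Gamma> \<tau>) = 0"
  then show "coset_trace \<tau> = 0" using gamma_coset_trace[OF assms] by (simp add: gamma_def)
next
  assume zero: "coset_trace \<tau> = 0"
  have "coset_trace (dm \<Gamma> \<tau>) * a = 0" if "a \<in> R (ginv \<Gamma> \<tau>)" for a
    using coset_trace_commutes[OF _ assms _ that] zero assms by simp
  then have "coset_trace (dm \<Gamma> \<tau>) * u (ginv \<Gamma> \<tau>) i = 0" if "i \<in> {1..n (ginv \<Gamma> \<tau>)}" for i
    using u_in[OF _ that] assms by simp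
  then have "coset_trace (dm \<Gamma> \<tau>) *
      (\<Sum>i=1..n (ginv \<Gamma> \<tau>). u (ginv \<Gamma> \<tau>) i * v (ginv \<Gamma> (ginv \<Gamma> \<tau>)) i) = 0"
    by (simp add: sum_distrib_left mult.assoc[symmetric])
  then have "coset_trace (dm \<Gamma> \<tau>) * ident (R (rg \<Gamma> (ginv \<Gamma> \<tau>))) = 0"
    by (simp only: sum_u_v[OF ginv_simps(1)[OF assms]])
  moreover have "coset_trace (dm \<Gamma> \<tau>) * ident (R (dm \<Gamma> \<tau>)) = coset_trace (dm \<Gamma> \<tau>)"
    using ident_mult(2)[OF _ coset_trace_in[of "dm \<Gamma> \<tau>"]] assms by simp
  ultimately show "coset_trace (dm \<Gamma> \<tau>) = 0" using assms by simp
qed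

section \<open>Finiteness and the sum over all cosets\<close>

definition support :: "'g \<Rightarrow> 'g set" where
  "support e = (\<Union>p \<in> Poly_Mapping.keys (D (ident (R e))). supp (fst p))"

lemma finite_support: "finite (support e)"
  by (simp add: support_def)

lemma support_mor: "support e \<subseteq> mor \<Gamma>"
  using supp_mor by (auto simp: support_def)

text \<open>If the coset contains no degree of a left factor in \<open>D(1\<^sub>e)\<close>, the
  projection kills all left factors.\<close>

lemma coset_trace_meets_support:
  assumes "coset_trace \<tau> \<noteq> 0" shows "dcoset \<tau> \<inter> support (rg \<Gamma> \<tau>) \<noteq> {}"
proof
  assume *: "dcoset \<tau> \<inter> support (rg \<Gamma> \<tau>) = {}"
  have "coset_value \<tau> = frag_lift (\<lambda>_. 0) (D (ident (R (rg \<Gamma> \<tau>))))"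
    unfolding coset_value_def
  proof (rule frag_lift_cong_keys)
    fix p assume "p \<in> Poly_Mapping.keys (D (ident (R (rg \<Gamma> \<tau>))))"
    then have "dcoset \<tau> \<inter> supp (fst p) = {}" using * unfolding support_def by blast
    then show "coset_part \<tau> p = 0"
      by (simp add: coset_part_def case_prod_unfold proj_def)
  qed
  also have "\<dots> = 0" by (rule frag_lift_zero_fun)
  finally show False using assms by (simp add: coset_trace_def)
qed

text \<open>Distinct cosets are disjoint, so picking in each of them a member of the finite set
  \<open>support e\<close> is injective.\<close>

lemma finite_meeting_support:
  assumes "\<And>\<tau>. \<tau> \<in> W \<Longrightarrow> \<tau> \<in> mor \<Gamma> \<and> dcoset \<tau> \<inter> support e \<noteq> {}"
    and "\<And>\<tau> \<tau>'. \<tau> \<in> W \<Longrightarrow> \<tau>' \<in> W \<Longrightarrow> \<tau>' \<in> dcoset \<tau> \<Longrightarrow> \<tau> = \<tau>'"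
  shows "finite W"
proof -
  have "\<forall>\<tau>\<in>W. \<exists>\<sigma>. \<sigma> \<in> dcoset \<tau> \<inter> support e" using assms(1) by blast
  from bchoice[OF this] obtain g where g: "\<forall>\<tau>\<in>W. g \<tau> \<in> dcoset \<tau> \<inter> support e" ..
  have "inj_on g W"
  proof (rule inj_onI)
    fix \<tau> \<tau>' assume *: "\<tau> \<in> W" "\<tau>' \<in> W" "g \<tau> = g \<tau>'"
    then have "g \<tau> \<in> dcoset \<tau>" "g \<tau> \<in> dcoset \<tau>'" using g by (blast, metis IntD1)
    then have "\<tau>' \<in> dcoset \<tau>"
      using dcoset_overlap assms(1) * by blast
    then show "\<tau> = \<tau>'" using assms(2) * by blast
  qed
  moreover have "g ` W \<subseteq> support e" using g by blast
  ultimately show ?thesis using finite_support by (rule inj_on_finite)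
qed

text \<open>On left factors of \<open>D(1\<^sub>e)\<close> the projections onto the chosen cosets
  add up to left multiplication by \<open>1\<^sub>e\<close>. So the coset values add up to
  \<open>1\<^sub>e \<mu>(D(1\<^sub>e)) = 1\<^sub>e\<close>, which already has degree
  \<open>e\<close>.\<close>

lemma sum_coset_trace:
  assumes e: "e \<in> obj \<Gamma> (mor \<Gamma>)" and W: "finite W" "\<And>\<tau>. \<tau> \<in> W \<Longrightarrow> \<tau> \<in> mor \<Gamma> \<and> rg \<Gamma> \<tau> = e"
    and disj: "\<And>\<tau> \<tau>'. \<tau> \<in> W \<Longrightarrow> \<tau>' \<in> W \<Longrightarrow> \<tau>' \<in> dcoset \<tau> \<Longrightarrow> \<tau> = \<tau>'"
    and cover: "\<And>\<sigma>. \<sigma> \<in> support e \<Longrightarrow> rg \<Gamma> \<sigma> = e \<Longrightarrow> \<exists>\<tau>\<in>W. \<sigma> \<in> dcoset \<tau>"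
  shows "(\<Sum>\<tau>\<in>W. coset_trace \<tau>) = ident (R e)"
proof -
  let ?c = "D (ident (R e))"
  have sum_fun: "(\<Sum>\<tau>\<in>W. frag_lift (\<beta> \<tau>) c) = frag_lift (\<lambda>p. \<Sum>\<tau>\<in>W. \<beta> \<tau> p) c"
    for \<beta> :: "'g \<Rightarrow> 'r \<times> 'r \<Rightarrow> 'r" and c
    using W(1)
    by (induction W rule: finite_induct) (simp_all add: frag_lift_zero_fun frag_lift_add_fun)
  have "(\<Sum>\<tau>\<in>W. coset_value \<tau>) = (\<Sum>\<tau>\<in>W. frag_lift (coset_part \<tau>) ?c)"
    using W(2) by (intro sum.cong) (simp_all add: coset_value_def)
  also have "\<dots> = frag_lift (\<lambda>p. \<Sum>\<tau>\<in>W. coset_part \<tau> p) ?c"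
    by (rule sum_fun)
  also have "\<dots> = frag_lift (\<lambda>p. ident (R e) * (\<lambda>(x, y). x * y) p) ?c"
  proof (rule frag_lift_cong_keys)
    fix p assume p: "p \<in> Poly_Mapping.keys ?c"
    obtain x y where xy: "p = (x, y)" by (cases p)
    then have sub: "supp x \<subseteq> support e" using p by (force simp: support_def)
    have "(\<Sum>\<tau>\<in>W. proj (dcoset \<tau>) x) = proj (\<Union>\<tau>\<in>W. dcoset \<tau>) x"
    proof (rule proj_UN[OF W(1), symmetric])
      fix \<tau> \<tau>' assume *: "\<tau> \<in> W" "\<tau>' \<in> W" "\<tau> \<noteq> \<tau>'"
      then show "dcoset \<tau> \<inter> dcoset \<tau>' = {}"
        using dcoset_overlap W(2) disj by blast
    qed
    also have "\<dots> = proj {\<sigma> \<in> mor \<Gamma>. rg \<Gamma> \<sigma> = e} x"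
    proof (rule proj_cong_supp)
      have "dcoset \<tau> \<subseteq> {\<sigma> \<in> mor \<Gamma>. rg \<Gamma> \<sigma> = e}" if "\<tau> \<in> W" for \<tau>
        using W(2)[OF that] by (auto simp: dcoset_def)
      then show "(\<Union>\<tau>\<in>W. dcoset \<tau>) \<inter> supp x = {\<sigma> \<in> mor \<Gamma>. rg \<Gamma> \<sigma> = e} \<inter> supp x"
        using cover sub by blast
    qed
    also have "\<dots> = ident (R e) * x" by (rule ident_mult_eq_proj[OF e, symmetric])
    finally show "(\<Sum>\<tau>\<in>W. coset_part \<tau> p) = ident (R e) * (\<lambda>(x, y). x * y) p"
      unfolding xy coset_part_def by (simp add: mult.assoc[symmetric] flip: sum_distrib_right)
  qed
  also have "\<dots> = ident (R e) * ident (R e)"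
    unfolding frag_lift_mult_left[symmetric] mult_free_eq_frag_lift[symmetric] D_mult ..
  also have "\<dots> = ident (R e)"
    using ident_mult(1)[OF _ ident_in[OF e]] obj_simps[OF e] by simp
  finally have sum_value: "(\<Sum>\<tau>\<in>W. coset_value \<tau>) = ident (R e)" .
  have "(\<Sum>\<tau>\<in>W. coset_trace \<tau>) = proj {e} (\<Sum>\<tau>\<in>W. coset_value \<tau>)"
    unfolding proj_sum coset_trace_def using W(2) by (intro sum.cong) simp_all
  then show ?thesis
    using proj_homogeneous[of e "ident (R e)"] ident_in[OF e] obj_simps[OF e] by (simp add: sum_value)
qed

text \<open>
  The trace counts cosets of \<open>\<Lambda>\<close>, but \<open>1\<^sub>e\<close> is a sum over cosets of \<open>\<Delta>\<close>. These agree once the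
  domains are restricted to one object from each connected component of \<open>\<Delta>\<close>.
\<close>

lemma ex_component_representatives:
  "\<exists>P \<subseteq> obj \<Gamma> (mor \<Gamma>).
    (\<forall>f \<in> obj \<Gamma> (mor \<Gamma>). \<exists>\<delta>\<in>\<Delta>. dm \<Gamma> \<delta> = f \<and> rg \<Gamma> \<delta> \<in> P) \<and>
    (\<forall>\<delta>\<in>\<Delta>. dm \<Gamma> \<delta> \<in> P \<longrightarrow> rg \<Gamma> \<delta> \<in> P \<longrightarrow> dm \<Gamma> \<delta> = rg \<Gamma> \<delta>)"
proof -
  define K where "K f = {rg \<Gamma> \<delta> | \<delta>. \<delta> \<in> \<Delta> \<and> dm \<Gamma> \<delta> = f}" for f
  \<comment> \<open>\<open>p f\<close> depends only on the component \<open>K f\<close>, so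
    \<open>p\<close> is constant on components, and the objects that it fixes form a set of
    representatives.\<close>
  define p where "p f = (SOME g. g \<in> K f)" for f
  have K_sub: "K (rg \<Gamma> \<delta>) \<subseteq> K (dm \<Gamma> \<delta>)" if "\<delta> \<in> \<Delta>" for \<delta>
  proof
    fix g assume "g \<in> K (rg \<Gamma> \<delta>)"
    then obtain \<epsilon> where "\<epsilon> \<in> \<Delta>" "dm \<Gamma> \<epsilon> = rg \<Gamma> \<delta>" "g = rg \<Gamma> \<epsilon>" unfolding K_def by blast
    then show "g \<in> K (dm \<Gamma> \<delta>)"
      unfolding K_def using that \<Delta>_mor by (intro CollectI exI[of _ "comp \<Gamma> \<epsilon> \<delta>"]) simp
  qed
  have K_eq: "K (rg \<Gamma> \<delta>) = K (dm \<Gamma> \<delta>)" if "\<delta> \<in> \<Delta>" for \<delta>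
    using K_sub[OF that] K_sub[OF ginv_\<Delta>[OF that]] that \<Delta>_mor by simp
  have p_in: "p f \<in> K f" if f: "f \<in> obj \<Gamma> (mor \<Gamma>)" for f
  proof -
    have "f \<in> K f"
      unfolding K_def using obj_in_\<Delta>[OF f] obj_simps[OF f] by (intro CollectI exI[of _ f]) simp
    then show ?thesis unfolding p_def by (rule someI)
  qed
  have p_eq: "p (rg \<Gamma> \<delta>) = p (dm \<Gamma> \<delta>)" if "\<delta> \<in> \<Delta>" for \<delta>
    unfolding p_def K_eq[OF that] ..
  show ?thesis
  proof (intro exI[of _ "{f \<in> obj \<Gamma> (mor \<Gamma>). p f = f}"] conjI ballI impI)
    fix f assume "f \<in> obj \<Gamma> (mor \<Gamma>)"
    then obtain \<delta> where \<delta>: "\<delta> \<in> \<Delta>" "dm \<Gamma> \<delta> = f" "rg \<Gamma> \<delta> = p f"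
      using p_in[of f] unfolding K_def by auto
    then have "p (rg \<Gamma> \<delta>) = rg \<Gamma> \<delta>" using p_eq[OF \<delta>(1)] by simp
    then show "\<exists>\<delta>\<in>\<Delta>. dm \<Gamma> \<delta> = f \<and> rg \<Gamma> \<delta> \<in> {f \<in> obj \<Gamma> (mor \<Gamma>). p f = f}"
      using \<delta> rg_obj[OF \<Delta>_mor[OF \<delta>(1)]] by blast
  next
    fix \<delta> assume "\<delta> \<in> \<Delta>" "dm \<Gamma> \<delta> \<in> {f \<in> obj \<Gamma> (mor \<Gamma>). p f = f}"
      "rg \<Gamma> \<delta> \<in> {f \<in> obj \<Gamma> (mor \<Gamma>). p f = f}"
    then show "dm \<Gamma> \<delta> = rg \<Gamma> \<delta>" using p_eq[of \<delta>] by simp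
  qed blast
qed

text \<open>On the chosen \<open>r\<close>, each \<open>gamma\<close> returns
  \<open>c(\<tau>)\<close> or 0, so the trace is a sum of coset contributions that
  \<open>sum_coset_trace\<close> evaluates.\<close>

lemma ex_trace_ident:
  assumes e: "e \<in> obj \<Gamma> (mor \<Gamma>)"
  shows "\<exists>r \<in> invariants. rel_trace \<Gamma> \<Delta> T n u v e r = ident (R e)"
proof -
  obtain P where P: "P \<subseteq> obj \<Gamma> (mor \<Gamma>)"
    and P_cover: "\<And>f. f \<in> obj \<Gamma> (mor \<Gamma>) \<Longrightarrow> \<exists>\<delta>\<in>\<Delta>. dm \<Gamma> \<delta> = f \<and> rg \<Gamma> \<delta> \<in> P"
    and P_unique: "\<And>\<delta>. \<delta> \<in> \<Delta> \<Longrightarrow> dm \<Gamma> \<delta> \<in> P \<Longrightarrow> rg \<Gamma> \<delta> \<in> P \<Longrightarrow> dm \<Gamma> \<delta> = rg \<Gamma> \<delta>"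
    using ex_component_representatives by blast
  \<comment> \<open>An arrow to \<open>e\<close> is required because it ties the contribution of
    \<open>f\<close> to the finite set \<open>support e\<close>; this makes \<open>Q\<close>
    finite.\<close>
  define Q where "Q = {f \<in> P. coset_trace f \<noteq> 0 \<and> (\<exists>\<sigma>\<in>mor \<Gamma>. dm \<Gamma> \<sigma> = f \<and> rg \<Gamma> \<sigma> = e)}"
  \<comment> \<open>Domains of members of one coset of \<open>\<Delta>\<close> are joined by
    \<open>\<Delta>\<close>, so they coincide once they lie in \<open>P\<close>.\<close>
  have P_dm: "dm \<Gamma> \<sigma> = dm \<Gamma> \<tau>"
    if "\<sigma> \<in> mor \<Gamma>" "\<tau> \<in> mor \<Gamma>" "\<sigma> \<in> dcoset \<tau>" "dm \<Gamma> \<sigma> \<in> P" "dm \<Gamma> \<tau> \<in> P" for \<sigma> \<tau>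
    using P_unique[of "comp \<Gamma> (ginv \<Gamma> \<tau>) \<sigma>"] that by (simp add: dcoset_def)

  have "finite Q"
  proof -
    \<comment> \<open>With one arrow \<open>s f\<close> to \<open>e\<close> per object,
      \<open>c(s f)\<close> is nonzero, so its coset meets \<open>support e\<close>; different
      objects give different cosets.\<close>
    have "\<forall>f\<in>Q. \<exists>\<sigma>. \<sigma> \<in> mor \<Gamma> \<and> dm \<Gamma> \<sigma> = f \<and> rg \<Gamma> \<sigma> = e" unfolding Q_def by blast
    from bchoice[OF this] obtain s where
      s: "\<forall>f\<in>Q. s f \<in> mor \<Gamma> \<and> dm \<Gamma> (s f) = f \<and> rg \<Gamma> (s f) = e" ..
    have "finite (s ` Q)"
    proof (rule finite_meeting_support[of _ e])
      fix \<tau> assume "\<tau> \<in> s ` Q"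
      then have "\<tau> \<in> mor \<Gamma>" "dm \<Gamma> \<tau> \<in> Q" "rg \<Gamma> \<tau> = e" using s by auto
      then show "\<tau> \<in> mor \<Gamma> \<and> dcoset \<tau> \<inter> support e \<noteq> {}"
        using coset_trace_meets_support[of \<tau>] coset_trace_eq_0_iff[of \<tau>] by (auto simp: Q_def)
    next
      fix \<tau> \<tau>' assume "\<tau> \<in> s ` Q" "\<tau>' \<in> s ` Q" and coset: "\<tau>' \<in> dcoset \<tau>"
      then obtain f f' where f: "f \<in> Q" "f' \<in> Q" "\<tau> = s f" "\<tau>' = s f'" by blast
      with bspec[OF s f(1)] bspec[OF s f(2)] have "f' = f"
        using P_dm[OF _ _ coset] by (simp add: Q_def)
      then show "\<tau> = \<tau>'" using f by simp
    qed
    moreover have "inj_on s Q" using s by (metis inj_onI)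
    ultimately show ?thesis by (rule finite_imageD)
  qed
  have "Q \<subseteq> fin_obj \<Gamma> \<Delta>"
  proof
    fix f assume f: "f \<in> Q"
    then have f_obj: "f \<in> obj \<Gamma> (mor \<Gamma>)" using P by (auto simp: Q_def)
    \<comment> \<open>Since \<open>c(f)\<close> is nonzero, so is \<open>c(\<tau>)\<close> for each
      loop \<open>\<tau>\<close> at \<open>f\<close>; its coset therefore meets the finite set
      \<open>support f\<close>.\<close>
    have "finite (hom_set \<Gamma> T f f)"
    proof (rule finite_meeting_support[of _ f])
      fix \<tau> assume "\<tau> \<in> hom_set \<Gamma> T f f"
      then have "\<tau> \<in> mor \<Gamma>" "dm \<Gamma> \<tau> = f" "rg \<Gamma> \<tau> = f" by (auto simp: hom_set_def T_mor)
      then show "\<tau> \<in> mor \<Gamma> \<and> dcoset \<tau> \<inter> support f \<noteq> {}"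
        using coset_trace_meets_support[of \<tau>] coset_trace_eq_0_iff[of \<tau>] f by (auto simp: Q_def)
    next
      fix \<tau> \<tau>' assume "\<tau> \<in> hom_set \<Gamma> T f f" "\<tau>' \<in> hom_set \<Gamma> T f f" "\<tau>' \<in> dcoset \<tau>"
      then show "\<tau> = \<tau>'" using T_unique[of \<tau>' \<tau>] by (simp add: hom_set_def)
    qed
    then show "f \<in> fin_obj \<Gamma> \<Delta>" using fin_obj_iff[OF f_obj] by blast
  qed

  define r where "r = (\<Sum>f\<in>Q. coset_trace f)"
  have Q_obj: "Q \<subseteq> obj \<Gamma> (mor \<Gamma>)" using P by (auto simp: Q_def)
  have obj_mor: "obj \<Gamma> (mor \<Gamma>) \<subseteq> mor \<Gamma>" by (auto simp: obj_iff)
  have trace_in: "coset_trace f \<in> R f" if "f \<in> Q" for f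
    using coset_trace_in[of f] obj_simps[of f] that Q_obj by auto
  have r0: "r \<in> part\<^sub>0"
    unfolding r_def using Q_obj trace_in homogeneous_in_part obj_mor by (intro part_sum) blast+
  have mult_r: "a * r = (if dm \<Gamma> \<sigma> \<in> Q then a * coset_trace (dm \<Gamma> \<sigma>) else 0)"
    if "\<sigma> \<in> mor \<Gamma>" "a \<in> R \<sigma>" for \<sigma> a
  proof -
    have "a * r = (\<Sum>f\<in>Q. if f = dm \<Gamma> \<sigma> then a * coset_trace f else 0)"
      unfolding r_def sum_distrib_left
    proof (rule sum.cong)
      fix f assume f: "f \<in> Q"
      then have "f \<in> mor \<Gamma>" "rg \<Gamma> f = f" using obj_simps[of f] Q_obj by auto
      then show "a * coset_trace f = (if f = dm \<Gamma> \<sigma> then a * coset_trace f else 0)"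
        using R_mult(2)[of \<sigma> f a "coset_trace f"] that trace_in[OF f] by auto
    qed simp
    then show ?thesis using \<open>finite Q\<close> by (simp add: sum.delta)
  qed
  have r_mult: "r * a = (if rg \<Gamma> \<sigma> \<in> Q then coset_trace (rg \<Gamma> \<sigma>) * a else 0)"
    if "\<sigma> \<in> mor \<Gamma>" "a \<in> R \<sigma>" for \<sigma> a
  proof -
    have "r * a = (\<Sum>f\<in>Q. if f = rg \<Gamma> \<sigma> then coset_trace f * a else 0)"
      unfolding r_def sum_distrib_right
    proof (rule sum.cong)
      fix f assume f: "f \<in> Q"
      then have "f \<in> mor \<Gamma>" "dm \<Gamma> f = f" using obj_simps[of f] Q_obj by auto
      then show "coset_trace f * a = (if f = rg \<Gamma> \<sigma> then coset_trace f * a else 0)"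
        using R_mult(2)[of f \<sigma> "coset_trace f" a] that trace_in[OF f] by auto
    qed simp
    then show ?thesis using \<open>finite Q\<close> by (simp add: sum.delta)
  qed
  have "r * a = a * r" if "a \<in> part R (Iso \<Gamma> \<Delta>)" for a
    using that Iso_subset
  proof (induction rule: part_induct)
    case (homogeneous \<kappa> a)
    then have \<kappa>: "\<kappa> \<in> mor \<Gamma>" "\<kappa> \<in> \<Delta>" "dm \<Gamma> \<kappa> = rg \<Gamma> \<kappa>" by (auto simp: mem_Iso \<Delta>_mor)
    \<comment> \<open>As an element of \<open>\<Delta>\<close>, \<open>\<kappa>\<close> lies in the
      coset of the identity at its domain, so \<open>c\<close> takes the same value on both.\<close>
    then have "\<kappa> \<in> dcoset (dm \<Gamma> \<kappa>)" using dm_obj[OF \<kappa>(1)] by (simp add: dcoset_def)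
    then have "coset_trace \<kappa> = coset_trace (dm \<Gamma> \<kappa>)"
      using \<kappa> by (intro coset_trace_cong) simp
    then have "a * coset_trace (dm \<Gamma> \<kappa>) = coset_trace (rg \<Gamma> \<kappa>) * a"
      using coset_trace_commutes[of \<kappa> "dm \<Gamma> \<kappa>" a] \<kappa> homogeneous by simp
    then show ?case
      using mult_r[of \<kappa> a] r_mult[of \<kappa> a] \<kappa> homogeneous by simp
  qed (simp_all add: distrib_left distrib_right)
  with r0 have r: "r \<in> invariants" by (simp add: centralizer_def)

  have gamma_r: "gamma \<Gamma> n u v \<tau> r = (if dm \<Gamma> \<tau> \<in> Q then coset_trace \<tau> else 0)"
    if \<tau>: "\<tau> \<in> mor \<Gamma>" for \<tau>
  proof -
    have "gamma \<Gamma> n u v \<tau> r = (if dm \<Gamma> \<tau> \<in> Q then gamma \<Gamma> n u v \<tau> (coset_trace (dm \<Gamma> \<tau>)) else 0)"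
      unfolding gamma_def using mult_r[OF \<tau> u_in[OF \<tau>]] by (auto intro!: sum.cong)
    then show ?thesis by (simp add: gamma_coset_trace[OF \<tau>])
  qed
  \<comment> \<open>Representatives with \<open>c(\<tau>) = 0\<close> are kept, so that
    \<open>W\<close> covers all degrees in \<open>support e\<close> with range \<open>e\<close>, as
    \<open>sum_coset_trace\<close> requires.\<close>
  define W where "W = {\<tau> \<in> T. rg \<Gamma> \<tau> = e \<and> dm \<Gamma> \<tau> \<in> P \<and> dcoset \<tau> \<inter> support e \<noteq> {}}"
  have W_disj: "\<tau> = \<tau>'" if "\<tau> \<in> W" "\<tau>' \<in> W" "\<tau>' \<in> dcoset \<tau>" for \<tau> \<tau>'
    using T_unique[of \<tau>' \<tau>] P_dm[OF _ _ that(3)] that by (simp add: W_def T_mor)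
  have "finite W"
  proof (rule finite_meeting_support[of _ e])
    fix \<tau> assume "\<tau> \<in> W"
    then show "\<tau> \<in> mor \<Gamma> \<and> dcoset \<tau> \<inter> support e \<noteq> {}" unfolding W_def using T_mor by blast
  qed (rule W_disj)
  have "rel_trace \<Gamma> \<Delta> T n u v e r =
      (\<Sum>\<tau> | \<tau> \<in> T \<and> rg \<Gamma> \<tau> = e \<and> dm \<Gamma> \<tau> \<in> Q. gamma \<Gamma> n u v \<tau> r)"
    using \<open>finite Q\<close> \<open>Q \<subseteq> fin_obj \<Gamma> \<Delta>\<close> by (rule rel_trace_eq) (simp add: gamma_r T_mor)
  also have "\<dots> = (\<Sum>\<tau> | \<tau> \<in> T \<and> rg \<Gamma> \<tau> = e \<and> dm \<Gamma> \<tau> \<in> Q. coset_trace \<tau>)"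
    by (intro sum.cong) (auto simp: gamma_r T_mor)
  also have "\<dots> = (\<Sum>\<tau>\<in>W. coset_trace \<tau>)"
  proof (rule sum.mono_neutral_left[OF \<open>finite W\<close>])
    show "{\<tau>. \<tau> \<in> T \<and> rg \<Gamma> \<tau> = e \<and> dm \<Gamma> \<tau> \<in> Q} \<subseteq> W"
    proof
      fix \<tau> assume "\<tau> \<in> {\<tau>. \<tau> \<in> T \<and> rg \<Gamma> \<tau> = e \<and> dm \<Gamma> \<tau> \<in> Q}"
      then have \<tau>: "\<tau> \<in> T" "\<tau> \<in> mor \<Gamma>" "rg \<Gamma> \<tau> = e" "dm \<Gamma> \<tau> \<in> Q" using T_mor by blast+
      then show "\<tau> \<in> W"
        using coset_trace_meets_support[of \<tau>] coset_trace_eq_0_iff[OF \<tau>(2)]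
        by (simp add: W_def Q_def)
    qed
    show "\<forall>\<tau>\<in>W - {\<tau>. \<tau> \<in> T \<and> rg \<Gamma> \<tau> = e \<and> dm \<Gamma> \<tau> \<in> Q}. coset_trace \<tau> = 0"
    proof
      fix \<tau> assume "\<tau> \<in> W - {\<tau>. \<tau> \<in> T \<and> rg \<Gamma> \<tau> = e \<and> dm \<Gamma> \<tau> \<in> Q}"
      then have \<tau>: "\<tau> \<in> mor \<Gamma>" "rg \<Gamma> \<tau> = e" "dm \<Gamma> \<tau> \<in> P" "dm \<Gamma> \<tau> \<notin> Q"
        unfolding W_def using T_mor by blast+
      then show "coset_trace \<tau> = 0"
        unfolding coset_trace_eq_0_iff[OF \<tau>(1)] Q_def by blast
    qed
  qed
  also have "\<dots> = ident (R e)"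
  proof (rule sum_coset_trace[OF e \<open>finite W\<close>])
    fix \<sigma> assume \<sigma>: "\<sigma> \<in> support e" "rg \<Gamma> \<sigma> = e"
    then have \<sigma>_mor: "\<sigma> \<in> mor \<Gamma>" using support_mor by blast
    obtain \<delta> where \<delta>: "\<delta> \<in> \<Delta>" "dm \<Gamma> \<delta> = dm \<Gamma> \<sigma>" "rg \<Gamma> \<delta> \<in> P"
      using P_cover[OF dm_obj[OF \<sigma>_mor]] by blast
    \<comment> \<open>Composing with the inverse of \<open>\<delta>\<close> moves the domain of
      \<open>\<sigma>\<close> into \<open>P\<close> without leaving the coset; the representative of
      the result then belongs to \<open>W\<close>.\<close>
    let ?\<sigma> = "comp \<Gamma> \<sigma> (ginv \<Gamma> \<delta>)"
    have \<sigma>': "?\<sigma> \<in> mor \<Gamma>" "dm \<Gamma> ?\<sigma> = rg \<Gamma> \<delta>" "rg \<Gamma> ?\<sigma> = e"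
      using \<sigma>_mor \<sigma> \<delta> \<Delta>_mor[OF \<delta>(1)] by simp_all
    obtain \<tau> where \<tau>: "\<tau> \<in> T" "\<tau> \<in> mor \<Gamma>" "dm \<Gamma> \<tau> = dm \<Gamma> ?\<sigma>" "rg \<Gamma> \<tau> = rg \<Gamma> ?\<sigma>"
      "?\<sigma> \<in> dcoset \<tau>" using ex_T[OF \<sigma>'(1)] .
    have "\<sigma> \<in> dcoset \<tau> \<longleftrightarrow> ?\<sigma> \<in> dcoset \<tau>"
      using \<sigma>_mor \<delta> \<tau>(2) \<Delta>_mor[OF \<delta>(1)] by (intro dcoset_comp_right) simp_all
    with \<tau>(5) have "\<sigma> \<in> dcoset \<tau>" by blast
    moreover from this have "\<tau> \<in> W" using \<tau> \<sigma>' \<sigma> \<delta> by (auto simp: W_def)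
    ultimately show "\<exists>\<tau>\<in>W. \<sigma> \<in> dcoset \<tau>" by blast
  next
    fix \<tau> assume "\<tau> \<in> W"
    then show "\<tau> \<in> mor \<Gamma> \<and> rg \<Gamma> \<tau> = e" unfolding W_def using T_mor by blast
  qed (rule W_disj)
  finally show ?thesis using r by blast
qed

end

text \<open>The object \<open>f\<close> can be taken to be \<open>e\<close> itself.\<close>

lemma (in relative_trace_setting) trace_if_separable:
  assumes "separable_extension (part R \<Delta>)" "e \<in> obj \<Gamma> (mor \<Gamma>)"
  shows "\<exists>f \<in> obj_class \<Gamma> e. \<exists>r \<in> invariants. rel_trace \<Gamma> \<Delta> T n u v f r = ident (R f)"
proof -
  from assms(1) obtain D where
    "\<forall>a x. tensor_cong (part R \<Delta>) (D (a * x)) (frag_lmul a (D x))"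
    "\<forall>a x. tensor_cong (part R \<Delta>) (D (x * a)) (frag_rmul (D x) a)"
    "\<forall>x. mult_free (D x) = x"
    unfolding separable_extension_iff by (elim conjE exE)
  then interpret separable_setting \<Gamma> R \<Delta> T n u v D
    by unfold_locales simp_all
  have "e \<in> obj_class \<Gamma> e"
    unfolding mem_obj_class using obj_simps[OF assms(2)] by (intro bexI[of _ e]) simp_all
  then show ?thesis using ex_trace_ident[OF assms(2)] by (intro bexI[of _ e])
qed

theorem theorem5:
  fixes \<Gamma> :: "'g cat" and R :: "'g \<Rightarrow> 'r::ring set" and \<Delta> \<Lambda> T :: "'g set"
    and n :: "'g \<Rightarrow> nat" and u v :: "'g \<Rightarrow> nat \<Rightarrow> 'r"
  assumes "groupoid \<Gamma>"
    and "strongly_graded \<Gamma> R"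
    and "object_unital \<Gamma> R"
    and "wide_subgroupoid \<Gamma> \<Delta>"
    and "\<Lambda> = Iso \<Gamma> \<Delta>"
    and "unit_decomposition \<Gamma> R n u v"
    and "right_transversal \<Gamma> \<Lambda> T"
  shows "separable_extension (part R \<Delta>) \<longleftrightarrow>
    (\<forall>e \<in> obj \<Gamma> (mor \<Gamma>). \<exists>f \<in> obj_class \<Gamma> e.
       \<exists>r \<in> centralizer (part R (obj \<Gamma> (mor \<Gamma>))) (part R \<Lambda>).
         rel_trace \<Gamma> \<Delta> T n u v f r = ident (R f))"
proof -
  interpret groupoid \<Gamma> by (rule assms(1))
  interpret relative_trace_setting \<Gamma> R \<Delta> T n u v
    using assms by unfold_locales (simp_all add: strongly_graded_def)
  show ?thesis
    unfolding assms(5) using separable_if_trace trace_if_separable by (intro iffI ballI)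
qed

end
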